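(* Let $0\le n\le q-2k$. Suppose that for every arc $G\subset\mathbb{F}_q^k$ of size $2k-2+n$, the column space of the matrix $H_G^{\uparrow n}$ contains the vector $v\in\mathbb{F}_q^{\binom{2k-2+n}{k-1}}$ with $v_i=1$ for $i\in\{1,\dots,k\}$ and $v_i=0$ otherwise (coordinates numbered according to the colex order of the rows). Then the normal rational curve $\mathcal{R}_k$ is the unique arc in $\mathbb{F}_q^k$ of size $q+1$ up to linear equivalence.
   Context: $\mathbb{F}_q$ is a finite field of order $q$ and characteristic $p$. An arc in $\mathbb{F}_q^k$ is an ordered family of at least $k$ vectors in which every subfamily of size $k$ is a basis; subfamilies inherit the order. Two arcs $G,G'$ are linearly equivalent if, for a basis $B$, the matrix whose columns are the vectors of $G$ in coordinates w.r.t. $B$ can be transformed into the corresponding matrix of $G'$ by elementary row operations, column permutations, and multiplying columns by nonzero scalars. The normal rational curve is $\mathcal{R}_k=\{(1,t,t^2,\dots,t^{k-1}): t\in\mathbb{F}_q\}\cup\{(0,\dots,0,1)\}$. $\binom{X}{m}$ is the set of $m$-subsets of $X$. For a basis $B$, a vector $u$ and $C\in\binom{G}{k-1}$, $\det(u,C)_B$ is the determinant of the matrix with first row $u$ and remaining rows the elements of $C$ in the order inherited from $G$, all in coordinates w.r.t. $B$. For $0\le n\le|G|-k+1$, $M_G^{\uparrow n}$ has rows indexed by $\binom{G}{k-1}$, columns indexed by pairs $(U,A)$ with $U\in\binom{G}{n}$, $A\in\binom{G\setminus U}{k-2}$, and $(C,(U,A))$-entry $\prod_{u\in U}\det(u,C)_B$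 if $A\subset C\subset G\setminus U$, else $0$. For an ordered set, $A$ precedes $A'$ in colex order if the largest element of $A\triangle A'$ lies in $A'$. For $C\in\binom{G}{k-1}$ let $L_C$ be the last element of $\binom{G\setminus C}{n}$ in colex order, and let $J_G^{\uparrow n}$ be the diagonal matrix indexed by $\binom{G}{k-1}$ with $(C,C)$-entry $\prod_{y\in L_C}\det(y,C)_B^{-1}$. Then $H_G^{\uparrow n}=J_G^{\uparrow n}M_G^{\uparrow n}$, with its rows listed in colex order. *)

theory Defs
  imports
    "Jordan_Normal_Form.Determinant"
    "Jordan_Normal_Form.VS_Connect"
    "Jordan_Normal_Form.Column_Operations"
    "HOL-Library.Cardinality"
    "HOL-Library.Nat_Bijection"
begin

definition ordered_basis :: "nat \<Rightarrow> 'a::field vec list \<Rightarrow> bool" where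
  "ordered_basis k B \<longleftrightarrow>
     distinct B \<and> vectorspace.basis class_ring (module_vec TYPE('a) k) (set B)"

text \<open>
  An ordered family of vectors is a list \<open>G\<close>. Its subfamilies are addressed by sets
  \<open>I\<close> of positions, and \<open>nths G I\<close> is the subfamily with the inherited order.
\<close>

definition is_arc :: "nat \<Rightarrow> 'a::field vec list \<Rightarrow> bool" where
  "is_arc k G \<longleftrightarrow> k \<le> length G \<and>
     (\<forall>I \<subseteq> {..<length G}. card I = k \<longrightarrow> ordered_basis k (nths G I))"

definition normal_rational_curve :: "nat \<Rightarrow> 'a::field vec set" where
  "normal_rational_curve k = range (\<lambda>t. vec k (\<lambda>i. t ^ i)) \<union> {unit_vec k (k - 1)}"

definition coords :: "nat \<Rightarrow> 'a::field vec list \<Rightarrow> 'a vec \<Rightarrow> 'a vec" where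
  "coords k B u = (THE c. c \<in> carrier_vec k \<and> mat_of_cols k B *\<^sub>v c = u)"

inductive equiv_step :: "'a::field mat \<Rightarrow> 'a mat \<Rightarrow> bool" where
  swap_rows: "i < dim_row A \<Longrightarrow> j < dim_row A \<Longrightarrow> equiv_step A (swaprows i j A)"
| scale_row: "i < dim_row A \<Longrightarrow> c \<noteq> 0 \<Longrightarrow> equiv_step A (multrow i c A)"
| add_row: "i < dim_row A \<Longrightarrow> j < dim_row A \<Longrightarrow> i \<noteq> j \<Longrightarrow> equiv_step A (addrow c i j A)"
| permute_cols: "\<pi> permutes {..<dim_col A} \<Longrightarrow>
    equiv_step A (mat (dim_row A) (dim_col A) (\<lambda>(i, j). A $$ (i, \<pi> j)))"
| scale_col: "j < dim_col A \<Longrightarrow> c \<noteq> 0 \<Longrightarrow> equiv_step A (multcol j c A)"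

definition linearly_equivalent ::
  "nat \<Rightarrow> 'a::field vec list \<Rightarrow> 'a vec list \<Rightarrow> 'a vec list \<Rightarrow> bool" where
  "linearly_equivalent k B G G' \<longleftrightarrow>
     equiv_step\<^sup>*\<^sup>* (mat_of_cols k (map (coords k B) G)) (mat_of_cols k (map (coords k B) G'))"

definition subsets_of_size :: "'b set \<Rightarrow> nat \<Rightarrow> 'b set set" where
  "subsets_of_size X m = {S. S \<subseteq> X \<and> card S = m}"

definition colex_less :: "nat set \<Rightarrow> nat set \<Rightarrow> bool" where
  "colex_less A A' \<longleftrightarrow> A \<noteq> A' \<and> Max (sym_diff A A') \<in> A'"

definition colex_list :: "nat set set \<Rightarrow> nat set list" where
  "colex_list S = (THE xs. set xs = S \<and> sorted_wrt colex_less xs)"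

lemma colex_less_imp_set_encode_less:
  assumes "finite A" "finite B" "colex_less A B"
  shows "set_encode A < set_encode B"
proof -
  define m where "m = Max (sym_diff A B)"
  have ne: "sym_diff A B \<noteq> {}" and mB: "m \<in> B"
    using assms(3) by (auto simp: colex_less_def m_def)
  have fin: "finite (sym_diff A B)" using assms by simp
  have mA: "m \<notin> A" using Max_in[OF fin ne] mB by (auto simp: m_def)
  have agree: "x \<in> A \<longleftrightarrow> x \<in> B" if "x > m" for x
    using Max_ge[OF fin, of x] that by (auto simp: m_def)
  define C where "C = {x \<in> A. x > m}"
  have finC: "finite C" using assms(1) by (simp add: C_def)
  have "A = C \<union> {x \<in> A. x < m}" using mA by (auto simp: C_def not_less_iff_gr_or_eq)
  then have "sum ((^) 2) A = sum ((^) 2) (C \<union> {x \<in> A. x < m} :: nat set)" by simp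
  also have "\<dots> = sum ((^) 2) C + sum ((^) 2) {x \<in> A. x < m}"
    using assms(1) by (subst sum.union_disjoint) (auto simp: C_def)
  also have "sum ((^) 2) {x \<in> A. x < m} \<le> sum ((^) (2::nat)) {..<m}"
    by (rule sum_mono2) auto
  also have "sum ((^) (2::nat)) {..<m} < 2 ^ m"
    by (induction m) auto
  finally have "sum ((^) (2::nat)) A < sum ((^) 2) C + 2 ^ m" by simp
  also have "\<dots> = sum ((^) 2) (insert m C)" using finC by (simp add: C_def)
  also have "\<dots> \<le> sum ((^) 2) B"
    using assms(2) mB agree by (intro sum_mono2) (auto simp: C_def)
  finally show ?thesis by (simp add: set_encode_def)
qed

lemma colex_less_iff_set_encode_less:
  assumes "finite A" "finite B"
  shows "colex_less A B \<longleftrightarrow> set_encode A < set_encode B"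
proof
  assume less: "set_encode A < set_encode B"
  then have "A \<noteq> B" by auto
  then have "Max (sym_diff A B) \<in> sym_diff A B" using assms by (intro Max_in) auto
  then have "colex_less A B \<or> colex_less B A"
    using \<open>A \<noteq> B\<close> by (auto simp: colex_less_def Un_commute)
  then show "colex_less A B"
    using colex_less_imp_set_encode_less[OF assms(2,1)] less by auto
qed (rule colex_less_imp_set_encode_less[OF assms])

lemma colex_list_unique:
  assumes "finite S" "\<And>A. A \<in> S \<Longrightarrow> finite A"
  shows "\<exists>!xs. set xs = S \<and> sorted_wrt colex_less xs"
proof -
  have iff: "sorted_wrt colex_less xs \<longleftrightarrow> sorted_wrt (<) (map set_encode xs)"
    if "set xs = S" for xs
  proof -
    have "colex_less (xs ! i) (xs ! j) \<longleftrightarrow> set_encode (xs ! i) < set_encode (xs ! j)"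
      if "i < j" "j < length xs" for i j
      using that nth_mem[of i xs] nth_mem[of j xs] \<open>set xs = S\<close> assms(2)
      by (intro colex_less_iff_set_encode_less) auto
    then show ?thesis by (simp add: sorted_wrt_iff_nth_less)
  qed
  have inj: "inj_on set_encode S"
    using assms(2) by (metis inj_onI set_encode_inverse)
  show ?thesis
  proof (rule ex_ex1I)
    let ?xs = "map set_decode (sorted_list_of_set (set_encode ` S))"
    have "set ?xs = S" using assms by (force simp: image_image)
    moreover have "map set_encode ?xs = sorted_list_of_set (set_encode ` S)"
      by (simp add: comp_def)
    ultimately show "\<exists>xs. set xs = S \<and> sorted_wrt colex_less xs"
      using iff by (metis strict_sorted_list_of_set)
  next
    fix xs ys assume xs: "set xs = S \<and> sorted_wrt colex_less xs"
      and ys: "set ys = S \<and> sorted_wrt colex_less ys"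
    then have "map set_encode xs = map set_encode ys"
      using iff by (intro strict_sorted_equal) auto
    then show "xs = ys" using xs ys inj by (metis inj_on_map_eq_map sup.idem)
  qed
qed

text \<open>
  \<open>C\<close>, \<open>U\<close>, \<open>A\<close> are sets of positions in \<open>G\<close>. The column indices presuppose \<open>2 \<le> k\<close>
  (\<open>k - 2\<close> is truncated subtraction), and \<open>last_set\<close> presupposes \<open>n + k \<le> length G + 1\<close>.
  The order chosen for the columns is immaterial for the column space.
\<close>

definition arc_det :: "nat \<Rightarrow> 'a::field vec list \<Rightarrow> 'a vec list \<Rightarrow> nat \<Rightarrow> nat set \<Rightarrow> 'a" where
  "arc_det k B G u C = det (mat_of_rows k (map (coords k B) (G ! u # nths G C)))"

definition row_indices :: "nat \<Rightarrow> 'a vec list \<Rightarrow> nat set list" where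
  "row_indices k G = colex_list (subsets_of_size {..<length G} (k - 1))"

definition col_indices :: "nat \<Rightarrow> nat \<Rightarrow> 'a vec list \<Rightarrow> (nat set \<times> nat set) list" where
  "col_indices k n G =
     concat (map (\<lambda>U. map (Pair U) (colex_list (subsets_of_size ({..<length G} - U) (k - 2))))
       (colex_list (subsets_of_size {..<length G} n)))"

definition M_mat :: "nat \<Rightarrow> 'a::field vec list \<Rightarrow> nat \<Rightarrow> 'a vec list \<Rightarrow> 'a mat" where
  "M_mat k B n G =
     mat (length (row_indices k G)) (length (col_indices k n G))
       (\<lambda>(i, j). let C = row_indices k G ! i; (U, A) = col_indices k n G ! j in
          if A \<subseteq> C \<and> C \<subseteq> {..<length G} - U then (\<Prod>u\<in>U. arc_det k B G u C) else 0)"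

definition last_set :: "nat \<Rightarrow> 'a vec list \<Rightarrow> nat set \<Rightarrow> nat set" where
  "last_set n G C = last (colex_list (subsets_of_size ({..<length G} - C) n))"

definition J_mat :: "nat \<Rightarrow> 'a::field vec list \<Rightarrow> nat \<Rightarrow> 'a vec list \<Rightarrow> 'a mat" where
  "J_mat k B n G =
     mat (length (row_indices k G)) (length (row_indices k G))
       (\<lambda>(i, j). if i = j then
          (let C = row_indices k G ! i in \<Prod>y\<in>last_set n G C. inverse (arc_det k B G y C)) else 0)"

definition H_mat :: "nat \<Rightarrow> 'a::field vec list \<Rightarrow> nat \<Rightarrow> 'a vec list \<Rightarrow> 'a mat" where
  "H_mat k B n G = J_mat k B n G * M_mat k B n G"

definition column_space :: "'a::field mat \<Rightarrow> 'a vec set" where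
  "column_space A = vec_space.col_space (dim_row A) A"

end

theory Submission
  imports Defs "Jordan_Normal_Form.DL_Rank" "HOL-Computational_Algebra.Polynomial"
begin

text \<open>
  Let \<open>S\<close> be an arc of size \<open>q + 1\<close> and write \<open>d z C\<close> for the determinant of the vector \<open>z\<close> followed
  by the \<open>k - 1\<close> vectors of \<open>C\<close>. Projecting from \<open>k - 2\<close> points of \<open>S\<close> to the projective line,
  Wilson's theorem and Lagrange interpolation show that the numbers
  \<open>inverse ((\<Prod>z\<in>S - C. d z C) * (\<Prod>y\<in>G - C. d y C))\<close> form a left null vector of \<open>M\<close> for every
  subfamily \<open>G\<close> of \<open>S\<close> of size \<open>2 * k - 2 + n\<close>. Pairing it with the vector \<open>v\<close> of the hypothesis
  leaves a relation on the first \<open>k\<close> rows, which are the facets of the basis formed by the first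
  \<open>k\<close> points \<open>F\<close> of \<open>G\<close>: in coordinates with respect to \<open>F\<close> it reads
  \<open>(\<Sum>i<k. e i * (\<Prod>y\<in>Y. inverse (y $ i))) = 0\<close> for all sets \<open>Y\<close> of \<open>k - 2\<close> points of \<open>S - F\<close>,
  with nonzero \<open>e i\<close> that do not depend on \<open>Y\<close>. This forces the coordinatewise inverses of the
  points of \<open>S - F\<close> onto a projective line. Inverting again and counting points identifies \<open>S\<close> with
  the image of the projective line under a basis of the forms of degree \<open>k - 1\<close>, that is, with a
  normal rational curve.
\<close>

subsection \<open>The projective line over a finite field\<close>

text \<open>Multiplication by a nonzero \<open>x\<close> permutes the nonzero elements, so their
  product absorbs the factor \<open>x ^ (CARD('a) - 1)\<close>.\<close>

lemma finite_field_power_card: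
  fixes x :: "'a::{field,finite}"
  shows "x ^ CARD('a) = x"
proof (cases "x = 0")
  case False
  let ?P = "\<Prod>y\<in>UNIV - {0::'a}. y"
  have "?P = (\<Prod>y\<in>UNIV - {0}. x * y)"
    by (rule prod.reindex_bij_witness[of _ "\<lambda>y. x * y" "\<lambda>y. y / x"]) (use False in auto)
  also have "\<dots> = x ^ (CARD('a) - 1) * ?P"
    by (simp add: prod.distrib)
  finally have "x ^ (CARD('a) - 1) = 1" by simp
  then have "x ^ Suc (CARD('a) - 1) = x" by (simp only: power_Suc2 mult_1)
  then show ?thesis using zero_less_card_finite[where 'a = 'a] by simp
qed (simp add: zero_less_card_finite)

lemma finite_field_power_card_minus_1:
  fixes x :: "'a::{field,finite}"
  assumes "x \<noteq> 0"
  shows "x ^ (CARD('a) - 1) = 1"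
proof -
  have "x * x ^ (CARD('a) - 1) = x * 1"
    using finite_field_power_card[of x] zero_less_card_finite[where 'a = 'a]
    by (simp flip: power_Suc)
  then show ?thesis using assms by simp
qed

text \<open>\<open>X ^ m - 1\<close> and the product of all \<open>X - y\<close> with
  \<open>y\<close> nonzero are monic of degree \<open>m\<close> and share \<open>m\<close> roots, so
  they coincide; the claim is read off at 0.\<close>

lemma finite_field_wilson: "(\<Prod>y\<in>UNIV - {0::'a::{field,finite}}. y) = - 1"
proof -
  let ?U = "UNIV - {0::'a}"
  define m where "m = CARD('a) - 1"
  have card_U: "card ?U = m" by (simp add: m_def)
  have "card {0, 1::'a} \<le> CARD('a)" by (rule card_mono) auto
  then have m: "m > 0" by (simp add: m_def)
  define g where "g = (\<Prod>y\<in>?U. [:- y, 1:])"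
  define p where "p = monom 1 m - 1 - g"
  have deg_g: "degree g = m" unfolding g_def by (subst degree_prod_eq_sum_degree) (auto simp: card_U)
  moreover have "lead_coeff g = 1" unfolding g_def lead_coeff_prod by simp
  ultimately have "coeff p m = 0" using m by (simp add: p_def)
  have root: "poly p y = 0" if "y \<in> ?U" for y
  proof -
    have "poly g y = 0" using that by (auto simp: g_def poly_prod)
    then show ?thesis using finite_field_power_card_minus_1[of y] that
      by (simp add: p_def poly_monom m_def)
  qed
  have "p = 0"
  proof (rule ccontr)
    assume p: "p \<noteq> 0"
    have "degree p \<le> m" unfolding p_def
      by (intro degree_diff_le) (auto simp: degree_monom_le deg_g)
    moreover have "degree p \<noteq> m" using \<open>coeff p m = 0\<close> p by (metis leading_coeff_0_iff)
    moreover have "card ?U \<le> card {y. poly p y = 0}"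
      using root by (intro card_mono poly_roots_finite p) auto
    ultimately show False using card_poly_roots_bound[OF p] card_U by linarith
  qed
  then have "poly p 0 = 0" by simp
  then have "(\<Prod>y\<in>?U. - y) = - 1"
    using m by (simp add: p_def g_def poly_monom poly_prod power_0_left)
  \<comment> \<open>Negation permutes the nonzero elements, which settles the sign in every
    characteristic at once.\<close>
  also have "(\<Prod>y\<in>?U. - y) = (\<Prod>y\<in>?U. y)"
    by (rule prod.reindex_bij_witness[of _ uminus uminus]) auto
  finally show ?thesis .
qed

section \<open>Homogeneous Lagrange interpolation on the projective line\<close>

text \<open>The 2 by 2 determinant of homogeneous coordinates: over a field, it vanishes on two
  nonzero pairs exactly when they represent the same point of the projective line.\<close>

definition bracket :: "'a::comm_ring_1 \<times> 'a \<Rightarrow> 'a \<times> 'a \<Rightarrow> 'a" where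
  "bracket x y = fst x * snd y - snd x * fst y"

text \<open>The top divided difference of a binary form of degree \<open>card T\<close> vanishes on
  \<open>card T + 2\<close> points; the form is a product of linear factors
  \<open>bracket \<tau>\<close>. The induction writes one factor as a combination of the brackets
  with two nodes \<open>b\<close> and \<open>c\<close>.\<close>

lemma bracket_interpolation:
  fixes \<phi> :: "'i \<Rightarrow> 'a::field \<times> 'a"
  assumes "finite T" "finite E" "card E = card T + 2"
    and "\<And>a b. a \<in> E \<Longrightarrow> b \<in> E \<Longrightarrow> a \<noteq> b \<Longrightarrow> bracket (\<phi> a) (\<phi> b) \<noteq> 0"
  shows "(\<Sum>a\<in>E. (\<Prod>\<tau>\<in>T. bracket \<tau> (\<phi> a)) / (\<Prod>u\<in>E - {a}. bracket (\<phi> u) (\<phi> a))) = 0"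
  using assms
proof (induction T arbitrary: E rule: finite_induct)
  case empty
  then have "card E = 2" by simp
  then obtain a b where "E = {a, b}" "a \<noteq> b" by (auto simp: card_2_iff)
  moreover have "bracket (\<phi> b) (\<phi> a) = - bracket (\<phi> a) (\<phi> b)" by (simp add: bracket_def)
  ultimately show ?case by (simp add: insert_Diff_if)
next
  case (insert \<tau> T)
  note nz = insert.prems(3)
  have "card E \<ge> 2" using insert.prems by simp
  then obtain B where "B \<subseteq> E" "card B = 2" by (meson obtain_subset_with_card_n)
  then obtain b c where bc: "b \<in> E" "c \<in> E" "b \<noteq> c" by (auto simp: card_2_iff)
  define \<beta> where "\<beta> = bracket \<tau> (\<phi> c) / bracket (\<phi> b) (\<phi> c)"
  define \<gamma> where "\<gamma> = bracket \<tau> (\<phi> b) / bracket (\<phi> c) (\<phi> b)"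
  have nzbc: "bracket (\<phi> b) (\<phi> c) \<noteq> 0" using nz bc by blast
  have anti: "bracket (\<phi> c) (\<phi> b) = - bracket (\<phi> b) (\<phi> c)" by (simp add: bracket_def)
  have decomp: "bracket \<tau> x = \<beta> * bracket (\<phi> b) x + \<gamma> * bracket (\<phi> c) x" for x
  proof -
    have "bracket \<tau> x * bracket (\<phi> b) (\<phi> c)
        = bracket \<tau> (\<phi> c) * bracket (\<phi> b) x - bracket \<tau> (\<phi> b) * bracket (\<phi> c) x"
      by (simp add: bracket_def algebra_simps)
    then show ?thesis using nzbc by (simp add: \<beta>_def \<gamma>_def anti field_simps)
  qed
  let ?t = "\<lambda>E a. (\<Prod>\<tau>\<in>T. bracket \<tau> (\<phi> a)) / (\<Prod>u\<in>E - {a}. bracket (\<phi> u) (\<phi> a))"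
  \<comment> \<open>The factor \<open>bracket (\<phi> d) (\<phi> a)\<close> kills the term of
    \<open>d\<close> and cancels the node \<open>d\<close> from every other denominator, leaving the
    sum for \<open>T\<close> over \<open>E - {d}\<close>.\<close>
  have part: "(\<Sum>a\<in>E. bracket (\<phi> d) (\<phi> a) * ?t E a) = 0" if d: "d \<in> E" for d
  proof -
    have "(\<Sum>a\<in>E. bracket (\<phi> d) (\<phi> a) * ?t E a) = (\<Sum>a\<in>E - {d}. bracket (\<phi> d) (\<phi> a) * ?t E a)"
      using insert.prems(1) d by (subst sum.remove[of _ d]) (auto simp: bracket_def)
    also have "\<dots> = (\<Sum>a\<in>E - {d}. ?t (E - {d}) a)"
    proof (rule sum.cong[OF refl])
      fix a assume a: "a \<in> E - {d}"
      have "(\<Prod>u\<in>E - {a}. bracket (\<phi> u) (\<phi> a))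
          = bracket (\<phi> d) (\<phi> a) * (\<Prod>u\<in>E - {d} - {a}. bracket (\<phi> u) (\<phi> a))"
      proof -
        have "E - {a} - {d} = E - {d} - {a}" by auto
        then show ?thesis using a d insert.prems(1) by (subst prod.remove[of _ d]) auto
      qed
      then show "bracket (\<phi> d) (\<phi> a) * ?t E a = ?t (E - {d}) a"
        using nz[of d a] a d by auto
    qed
    also have "\<dots> = 0" using insert.prems insert.hyps d by (intro insert.IH) auto
    finally show ?thesis .
  qed
  have "(\<Sum>a\<in>E. (\<Prod>\<tau>\<in>insert \<tau> T. bracket \<tau> (\<phi> a)) / (\<Prod>u\<in>E - {a}. bracket (\<phi> u) (\<phi> a)))
      = (\<Sum>a\<in>E. bracket \<tau> (\<phi> a) * ?t E a)"
    using insert.hyps by simp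
  also have "\<dots> = \<beta> * (\<Sum>a\<in>E. bracket (\<phi> b) (\<phi> a) * ?t E a)
      + \<gamma> * (\<Sum>a\<in>E. bracket (\<phi> c) (\<phi> a) * ?t E a)"
    by (simp add: decomp sum_distrib_left sum.distrib distrib_right mult.assoc add_divide_distrib)
  also have "\<dots> = 0" using part bc by simp
  finally show ?case .
qed

section \<open>Normalized points and the tangent function\<close>

text \<open>One fixed representative per point, since products of brackets change under
  scaling.\<close>

definition projective_line :: "('a::field \<times> 'a) set" where
  "projective_line = insert (0, 1) (range (Pair 1))"

lemma card_projective_line: "card (projective_line :: ('a::{field,finite} \<times> 'a) set) = CARD('a) + 1"
  by (auto simp: projective_line_def card_insert_if card_image inj_on_def)

text \<open>At \<open>(0, 1)\<close> every bracket is 1. At \<open>(1, t)\<close> the affine points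
  contribute all nonzero differences \<open>t - s\<close>, with product -1 by Wilson, and
  \<open>(0, 1)\<close> contributes another -1.\<close>

lemma prod_bracket_projective_line:
  fixes a :: "'a::{field,finite} \<times> 'a"
  assumes "a \<in> projective_line"
  shows "(\<Prod>\<tau>\<in>projective_line - {a}. bracket \<tau> a) = 1"
proof (cases "a = (0, 1)")
  case True
  then have "projective_line - {a} = range (Pair 1)" by (auto simp: projective_line_def)
  then show ?thesis using True by (auto simp: bracket_def intro!: prod.neutral)
next
  case False
  then obtain t where a: "a = (1, t)" using assms by (auto simp: projective_line_def)
  then have "projective_line - {a} = insert (0, 1) (Pair 1 ` (UNIV - {t}))"
    by (auto simp: projective_line_def)
  then have "(\<Prod>\<tau>\<in>projective_line - {a}. bracket \<tau> a)
      = bracket (0, 1) a * (\<Prod>\<tau>\<in>Pair 1 ` (UNIV - {t}). bracket \<tau> a)"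
    by (simp add: image_iff)
  also have "(\<Prod>\<tau>\<in>Pair 1 ` (UNIV - {t}). bracket \<tau> a) = (\<Prod>s\<in>UNIV - {t}. t - s)"
    by (subst prod.reindex) (auto simp: inj_on_def a bracket_def)
  also have "\<dots> = (\<Prod>y\<in>UNIV - {0}. y)"
    by (rule prod.reindex_bij_witness[of _ "\<lambda>y. t - y" "\<lambda>s. t - s"]) auto
  finally show ?thesis by (simp add: finite_field_wilson a bracket_def)
qed

text \<open>
  The product over the missing points \<open>T\<close> is the tangent function of Segre's lemma of tangents.
\<close>

lemma tangent_function:
  fixes \<phi> :: "'i \<Rightarrow> 'a::{field,finite} \<times> 'a"
  assumes "finite I" "\<And>a. a \<in> I \<Longrightarrow> \<phi> a \<noteq> (0, 0)"
    and nz: "\<And>a b. a \<in> I \<Longrightarrow> b \<in> I \<Longrightarrow> a \<noteq> b \<Longrightarrow> bracket (\<phi> a) (\<phi> b) \<noteq> 0"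
  obtains T \<kappa> where "\<kappa> \<noteq> 0" "finite T" "card T + card I = CARD('a) + 1"
    "\<And>a. a \<in> I \<Longrightarrow>
      (\<Prod>z\<in>I - {a}. bracket (\<phi> z) (\<phi> a)) * (\<Prod>\<tau>\<in>T. bracket \<tau> (\<phi> a)) = \<kappa>"
proof -
  \<comment> \<open>Each \<open>\<phi> a\<close> is the normalized representative
    \<open>\<rho> a\<close> times the scalar \<open>\<mu> a\<close>.\<close>
  define \<mu> where "\<mu> a = (if fst (\<phi> a) = 0 then snd (\<phi> a) else fst (\<phi> a))" for a
  define \<rho> :: "'i \<Rightarrow> 'a \<times> 'a"
    where "\<rho> a = (if fst (\<phi> a) = 0 then (0, 1) else (1, snd (\<phi> a) / fst (\<phi> a)))" for a
  have \<mu>: "\<mu> a \<noteq> 0" if "a \<in> I" for a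
    using assms(2)[OF that] by (auto simp: \<mu>_def prod_eq_iff)
  have \<rho>: "\<rho> a \<in> projective_line" for a by (auto simp: \<rho>_def projective_line_def)
  have \<phi>: "fst (\<phi> a) = \<mu> a * fst (\<rho> a)" "snd (\<phi> a) = \<mu> a * snd (\<rho> a)" for a
    by (auto simp: \<mu>_def \<rho>_def)
  have inj: "inj_on \<rho> I"
  proof (rule inj_onI)
    fix a b assume "a \<in> I" "b \<in> I" "\<rho> a = \<rho> b"
    then show "a = b" using nz[of a b] by (auto simp: bracket_def \<phi>)
  qed
  define T where "T = projective_line - \<rho> ` I"
  have "card T = card (projective_line :: ('a \<times> 'a) set) - card (\<rho> ` I)"
    unfolding T_def using \<rho> by (intro card_Diff_subset) (auto simp: assms(1))
  moreover have "card (\<rho> ` I) \<le> card (projective_line :: ('a \<times> 'a) set)"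
    using \<rho> by (intro card_mono) auto
  ultimately have card_T: "card T + card I = CARD('a) + 1"
    using inj by (simp add: card_image card_projective_line)
  have "(\<Prod>z\<in>I - {a}. bracket (\<phi> z) (\<phi> a)) * (\<Prod>\<tau>\<in>T. bracket \<tau> (\<phi> a)) = (\<Prod>z\<in>I. \<mu> z)"
    if a: "a \<in> I" for a
  proof -
    have "(\<Prod>z\<in>I - {a}. bracket (\<phi> z) (\<phi> a)) = (\<Prod>z\<in>I - {a}. \<mu> z * \<mu> a * bracket (\<rho> z) (\<rho> a))"
      by (intro prod.cong) (auto simp: bracket_def \<phi> algebra_simps)
    also have "\<dots> = (\<Prod>z\<in>I - {a}. \<mu> z) * \<mu> a ^ (card I - 1) * (\<Prod>z\<in>I - {a}. bracket (\<rho> z) (\<rho> a))"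
      using a assms(1) by (simp add: prod.distrib)
    also have "(\<Prod>z\<in>I - {a}. bracket (\<rho> z) (\<rho> a)) = (\<Prod>\<tau>\<in>\<rho> ` (I - {a}). bracket \<tau> (\<rho> a))"
      using inj by (subst prod.reindex) (auto simp: inj_on_def)
    finally have 1: "(\<Prod>z\<in>I - {a}. bracket (\<phi> z) (\<phi> a)) = (\<Prod>z\<in>I - {a}. \<mu> z) * \<mu> a ^ (card I - 1)
      * (\<Prod>\<tau>\<in>\<rho> ` (I - {a}). bracket \<tau> (\<rho> a))" .
    have "(\<Prod>\<tau>\<in>T. bracket \<tau> (\<phi> a)) = (\<Prod>\<tau>\<in>T. \<mu> a * bracket \<tau> (\<rho> a))"
      by (intro prod.cong) (auto simp: bracket_def \<phi> algebra_simps)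
    also have "\<dots> = \<mu> a ^ card T * (\<Prod>\<tau>\<in>T. bracket \<tau> (\<rho> a))"
      by (simp add: prod.distrib)
    finally have 2: "(\<Prod>\<tau>\<in>T. bracket \<tau> (\<phi> a)) = \<mu> a ^ card T * (\<Prod>\<tau>\<in>T. bracket \<tau> (\<rho> a))" .
    have "projective_line - {\<rho> a} = \<rho> ` (I - {a}) \<union> T"
      using inj a \<rho> by (auto simp: T_def inj_on_def)
    then have "(\<Prod>\<tau>\<in>\<rho> ` (I - {a}). bracket \<tau> (\<rho> a)) * (\<Prod>\<tau>\<in>T. bracket \<tau> (\<rho> a)) = 1"
      using prod_bracket_projective_line[OF \<rho>[of a]]
      by (subst prod.union_disjoint[symmetric]) (auto simp: T_def assms(1))
    \<comment> \<open>The scalar \<open>\<mu> a\<close> occurs \<open>CARD('a)\<close> times, which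
      amounts to once. This single factor completes the product over \<open>I - {a}\<close> to the
      one over \<open>I\<close>, which is independent of \<open>a\<close>.\<close>
    moreover have "\<mu> a ^ (card I - 1) * \<mu> a ^ card T = \<mu> a"
    proof -
      have "card I > 0" using a assms(1) by (auto simp: card_gt_0_iff)
      then have "card I - 1 + card T = CARD('a)" using card_T by linarith
      then show ?thesis by (simp flip: power_add add: finite_field_power_card)
    qed
    moreover have "x * m * p * (m' * p') = x * (m * m') * (p * p')" for x m p m' p' :: 'a
      by (simp only: mult_ac)
    ultimately have "(\<Prod>z\<in>I - {a}. bracket (\<phi> z) (\<phi> a)) * (\<Prod>\<tau>\<in>T. bracket \<tau> (\<phi> a))
        = (\<Prod>z\<in>I - {a}. \<mu> z) * \<mu> a"
      unfolding 1 2 by (metis mult_1_right)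
    then show ?thesis using prod.remove[OF assms(1) a, of \<mu>] by (simp add: mult.commute)
  qed
  moreover have "(\<Prod>z\<in>I. \<mu> z) \<noteq> 0" using \<mu> assms(1) by simp
  ultimately show thesis using card_T by (intro that) auto
qed

text \<open>The tangent function turns the inverse of the product over \<open>I - {a}\<close> into a
  constant times the product over the missing points \<open>T\<close>. The cardinalities give
  \<open>card E = card T + 2\<close>, as interpolation requires.\<close>

lemma bracket_kernel_identity:
  fixes \<phi> :: "'i \<Rightarrow> 'a::{field,finite} \<times> 'a"
  assumes "finite I" "E \<subseteq> I" "card E + card I = CARD('a) + 3" "card I \<ge> 2"
    and nz: "\<And>a b. a \<in> I \<Longrightarrow> b \<in> I \<Longrightarrow> a \<noteq> b \<Longrightarrow> bracket (\<phi> a) (\<phi> b) \<noteq> 0"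
  shows "(\<Sum>a\<in>E. inverse ((\<Prod>z\<in>I - {a}. bracket (\<phi> z) (\<phi> a)) *
           (\<Prod>u\<in>E - {a}. bracket (\<phi> u) (\<phi> a)))) = 0"
proof -
  have nonzero: "\<phi> a \<noteq> (0, 0)" if "a \<in> I" for a
  proof -
    have "\<not> I \<subseteq> {a}" using assms(4) card_mono[of "{a}" I] by auto
    then obtain b where "b \<in> I" "a \<noteq> b" by auto
    then show ?thesis using nz[of a b] that by (auto simp: bracket_def)
  qed
  obtain T \<kappa> where T: "\<kappa> \<noteq> 0" "finite T"
    "card T + card I = CARD('a) + 1"
    "\<And>a. a \<in> I \<Longrightarrow> (\<Prod>z\<in>I - {a}. bracket (\<phi> z) (\<phi> a)) * (\<Prod>\<tau>\<in>T. bracket \<tau> (\<phi> a)) = \<kappa>"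
    by (rule tangent_function[of I \<phi>, OF assms(1) nonzero nz]) auto
  have inv: "inverse (\<Prod>z\<in>I - {a}. bracket (\<phi> z) (\<phi> a)) = inverse \<kappa> * (\<Prod>\<tau>\<in>T. bracket \<tau> (\<phi> a))"
    if "a \<in> I" for a
    using T(4)[OF that] T(1) by (auto simp: field_simps)
  have "(\<Sum>a\<in>E. inverse ((\<Prod>z\<in>I - {a}. bracket (\<phi> z) (\<phi> a)) *
           (\<Prod>u\<in>E - {a}. bracket (\<phi> u) (\<phi> a))))
      = inverse \<kappa> * (\<Sum>a\<in>E. (\<Prod>\<tau>\<in>T. bracket \<tau> (\<phi> a)) / (\<Prod>u\<in>E - {a}. bracket (\<phi> u) (\<phi> a)))"
    unfolding sum_distrib_left using assms(2)
    by (intro sum.cong) (auto simp: inv divide_inverse)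
  also have "(\<Sum>a\<in>E. (\<Prod>\<tau>\<in>T. bracket \<tau> (\<phi> a)) / (\<Prod>u\<in>E - {a}. bracket (\<phi> u) (\<phi> a))) = 0"
    using T(2,3) assms(3) finite_subset[OF assms(2,1)] nz assms(2)
    by (intro bracket_interpolation) (auto 4 3)
  finally show ?thesis by simp
qed

subsection \<open>Determinants and vectors in general position\<close>

definition row_det :: "nat \<Rightarrow> 'a::field vec list \<Rightarrow> 'a" where
  "row_det k xs = det (mat_of_rows k xs)"

lemma row_det_eq_det_cols:
  "length xs = k \<Longrightarrow> row_det k xs = det (mat_of_cols k xs)"
  unfolding row_det_def
  by (subst det_transpose[symmetric, of _ k]) (auto simp: transpose_mat_of_rows carrier_matI)

lemma ordered_basis_iff_row_det:
  fixes xs :: "'a::field vec list"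
  shows "ordered_basis k xs \<longleftrightarrow> length xs = k \<and> set xs \<subseteq> carrier_vec k \<and> row_det k xs \<noteq> 0"
proof -
  interpret vec_space "TYPE('a)" k .
  show ?thesis
  proof
    assume ob: "ordered_basis k xs"
    then have d: "distinct xs" and b: "basis (set xs)" by (auto simp: ordered_basis_def)
    have "card (set xs) = k" using dim_basis[OF _ b] dim_is_n by simp
    then have l: "length xs = k" using d by (simp add: distinct_card)
    have c: "set xs \<subseteq> carrier_vec k" and li: "lin_indpt (set xs)"
      using b by (auto simp: basis_def)
    have A: "mat_of_cols k xs \<in> carrier_mat k k" using l by auto
    have "rank (mat_of_cols k xs) = k"
      using lin_indpt_full_rank[OF A] c d li by simp
    then show "length xs = k \<and> set xs \<subseteq> carrier_vec k \<and> row_det k xs \<noteq> 0"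
      using det_rank_iff[OF A] l c by (simp add: row_det_eq_det_cols)
  next
    assume h: "length xs = k \<and> set xs \<subseteq> carrier_vec k \<and> row_det k xs \<noteq> 0"
    then have A: "mat_of_rows k xs \<in> carrier_mat k k" by auto
    have rows: "rows (mat_of_rows k xs) = xs" using h by simp
    have li: "lin_indpt (set xs)"
      using det_not_0_imp_lin_indpt_rows[OF A] h rows by (simp add: row_det_def)
    have d: "distinct xs"
    proof (rule ccontr)
      assume "\<not> distinct xs"
      then obtain i j where "i < k" "j < k" "i \<noteq> j" "xs ! i = xs ! j"
        using h by (auto simp: distinct_conv_nth)
      moreover have "row (mat_of_rows k xs) i = xs ! i" if "i < k" for i
        using that h nth_mem[of i xs] by (intro mat_of_rows_row) auto
      ultimately show False
        using det_identical_rows[OF A, of i j] h by (simp add: row_det_def)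
    qed
    have "basis (set xs)"
      using h li d by (intro dim_li_is_basis) (auto simp: dim_is_n distinct_card)
    then show "ordered_basis k xs" using d by (simp add: ordered_basis_def)
  qed
qed

text \<open>Laplace expansion along the first row. The cofactors ignore that row, so they are
  computed with the zero vector in its place.\<close>

lemma row_det_functional:
  fixes xs :: "'a::field vec list"
  assumes "Suc (length xs) = k"
  obtains c where "c \<in> carrier_vec k"
    "\<And>x. x \<in> carrier_vec k \<Longrightarrow> row_det k (x # xs) = c \<bullet> x"
proof -
  let ?M = "\<lambda>x. mat_of_rows k (x # xs)"
  define c where "c = vec k (\<lambda>j. cofactor (?M (0\<^sub>v k)) 0 j)"
  have "row_det k (x # xs) = c \<bullet> x" if x: "x \<in> carrier_vec k" for x
  proof -
    have del: "mat_delete (?M x) 0 j = mat_delete (?M (0\<^sub>v k)) 0 j" for j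
      unfolding mat_delete_def by (rule eq_matI) (auto simp: mat_of_rows_def)
    have "row_det k (x # xs) = (\<Sum>j<k. ?M x $$ (0, j) * cofactor (?M x) 0 j)"
      unfolding row_det_def using assms by (intro laplace_expansion_row) (auto intro: carrier_matI)
    also have "\<dots> = (\<Sum>j<k. c $ j * x $ j)"
      by (rule sum.cong) (auto simp: mat_of_rows_index c_def cofactor_def del)
    also have "\<dots> = c \<bullet> x"
      using x by (simp add: scalar_prod_def atLeast0LessThan)
    finally show ?thesis .
  qed
  then show thesis by (intro that[of c]) (auto simp: c_def)
qed

lemma row_det_swap:
  fixes us vs :: "'a::field vec list"
  assumes "length us + length vs + 2 = k"
  shows "row_det k (us @ x # y # vs) = - row_det k (us @ y # x # vs)"
proof -
  let ?n = "length us"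
  have "mat_of_rows k (us @ x # y # vs) = swaprows ?n (Suc ?n) (mat_of_rows k (us @ y # x # vs))"
    by (rule eq_matI) (auto simp: mat_of_rows_def nth_append nth_Cons')
  then show ?thesis unfolding row_det_def
    using assms by (subst det_swaprows[of _ k, symmetric]) (auto intro: carrier_matI)
qed

lemma row_det_repeat:
  fixes xs :: "'a::field vec list"
  assumes "length xs = k" "set xs \<subseteq> carrier_vec k" "\<not> distinct xs"
  shows "row_det k xs = 0"
proof -
  have "\<not> ordered_basis k xs" using assms(3) by (simp add: ordered_basis_def)
  then show ?thesis using assms by (simp add: ordered_basis_iff_row_det)
qed

lemma row_det_move:
  fixes us xs vs :: "'a::field vec list"
  assumes "length us + length xs + length vs + 1 = k"
  shows "row_det k (us @ xs @ a # vs) = (- 1) ^ length xs * row_det k (us @ a # xs @ vs)"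
  using assms
proof (induction xs arbitrary: us)
  case (Cons x xs)
  have "row_det k (us @ (x # xs) @ a # vs) = (- 1) ^ length xs * row_det k ((us @ [x]) @ a # xs @ vs)"
    using Cons.IH[of "us @ [x]"] Cons.prems by simp
  also have "row_det k ((us @ [x]) @ a # xs @ vs) = - row_det k (us @ a # x # xs @ vs)"
    using row_det_swap[of us "xs @ vs" k x a] Cons.prems by simp
  finally show ?case by simp
qed simp

text \<open>The sign depends on the two tails alone, so a single sign serves every choice of the
  leading rows \<open>us\<close>.\<close>

lemma row_det_permute:
  fixes xs ys :: "'a::field vec list"
  assumes "mset xs = mset ys"
  obtains \<epsilon> where "\<epsilon> = 1 \<or> \<epsilon> = - 1"
    "\<And>us. length us + length xs = k \<Longrightarrow> row_det k (us @ xs) = \<epsilon> * row_det k (us @ ys)"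
proof -
  have "\<exists>\<epsilon>. (\<epsilon> = 1 \<or> \<epsilon> = - 1) \<and>
      (\<forall>us. length us + length xs = k \<longrightarrow> row_det k (us @ xs) = \<epsilon> * row_det k (us @ ys))"
    using assms
  proof (induction xs arbitrary: ys)
    case (Cons x xs)
    have "x \<in> set ys" using Cons.prems by (metis list.set_intros(1) mset_eq_setD)
    then obtain y1 y2 where ys: "ys = y1 @ x # y2" by (meson split_list)
    then have "mset xs = mset (y1 @ y2)" using Cons.prems by simp
    from Cons.IH[OF this] obtain \<epsilon> where \<epsilon>: "\<epsilon> = 1 \<or> \<epsilon> = - 1"
      "\<And>us. length us + length xs = k \<Longrightarrow> row_det k (us @ xs) = \<epsilon> * row_det k (us @ y1 @ y2)"
      by auto
    have len: "length xs = length y1 + length y2"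
      using mset_eq_length[OF \<open>mset xs = mset (y1 @ y2)\<close>] by simp
    have "row_det k (us @ x # xs) = (\<epsilon> * (- 1) ^ length y1) * row_det k (us @ ys)"
      if "length us + length (x # xs) = k" for us
    proof -
      have "row_det k (us @ x # xs) = \<epsilon> * row_det k (us @ x # y1 @ y2)"
        using \<epsilon>(2)[of "us @ [x]"] that by simp
      moreover have "row_det k (us @ ys) = (- 1) ^ length y1 * row_det k (us @ x # y1 @ y2)"
        unfolding ys using that len by (intro row_det_move) simp
      ultimately show ?thesis by (simp add: mult.assoc flip: power_mult_distrib)
    qed
    moreover have "\<epsilon> * (- 1) ^ length y1 = 1 \<or> \<epsilon> * (- 1) ^ length y1 = - 1"
      using \<epsilon>(1) by (cases "even (length y1)") auto
    ultimately show ?case by blast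
  qed auto
  then show thesis using that by blast
qed

lemma row_det_permute_nonzero:
  fixes xs ys :: "'a::field vec list"
  assumes "mset xs = mset ys" "length xs = k"
  shows "row_det k xs \<noteq> 0 \<longleftrightarrow> row_det k ys \<noteq> 0"
proof -
  obtain \<epsilon> where "\<epsilon> = 1 \<or> \<epsilon> = - 1"
    "\<And>us. length us + length xs = k \<Longrightarrow> row_det k (us @ xs) = \<epsilon> * row_det k (us @ ys)"
    by (rule row_det_permute[OF assms(1), where k = k]) (rule that)
  from this(1) this(2)[of "[]"] show ?thesis using assms(2) by auto
qed

lemma orthogonal_to_basis_imp_zero:
  fixes v :: "'a::field vec"
  assumes "row_det k xs \<noteq> 0" "length xs = k" "set xs \<subseteq> carrier_vec k" "v \<in> carrier_vec k"
    and "\<And>x. x \<in> set xs \<Longrightarrow> v \<bullet> x = 0"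
  shows "v = 0\<^sub>v k"
proof (rule ccontr)
  assume "v \<noteq> 0\<^sub>v k"
  have A: "mat_of_rows k xs \<in> carrier_mat k k" using assms(2) by auto
  have "mat_of_rows k xs *\<^sub>v v = 0\<^sub>v k"
  proof (rule eq_vecI)
    fix i assume i: "i < dim_vec (0\<^sub>v k :: 'a vec)"
    then have x: "xs ! i \<in> set xs" using assms(2) by simp
    then have "xs ! i \<bullet> v = 0"
      using assms(3-5) by (metis comm_scalar_prod subsetD)
    then show "(mat_of_rows k xs *\<^sub>v v) $ i = 0\<^sub>v k $ i"
      using i x assms(2,3) by (simp add: mat_of_rows_row subset_iff)
  qed (use assms(2) in auto)
  then have "det (mat_of_rows k xs) = 0"
    using det_0_iff_vec_prod_zero_field[OF A] \<open>v \<noteq> 0\<^sub>v k\<close> assms(4) by auto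
  then show False using assms(1) by (simp add: row_det_def)
qed

text \<open>A three-term Pluecker relation: both sides are linear in \<open>x\<close> and agree on
  the basis \<open>b\<close>, \<open>c\<close>, \<open>as\<close>. It says that projection from
  \<open>as\<close> to a line turns \<open>row_det\<close> into \<open>bracket\<close>, up to a
  constant factor.\<close>

lemma row_det_pluecker:
  fixes x y b c :: "'a::field vec"
  assumes "length as + 2 = k" "set as \<subseteq> carrier_vec k"
    and "x \<in> carrier_vec k" "y \<in> carrier_vec k" "b \<in> carrier_vec k" "c \<in> carrier_vec k"
    and "row_det k (b # c # as) \<noteq> 0"
  shows "row_det k (x # c # as) * row_det k (y # b # as) - row_det k (x # b # as) * row_det k (y # c # as)
    = - row_det k (b # c # as) * row_det k (x # y # as)"
proof -
  let ?d = "\<lambda>x y. row_det k (x # y # as)"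
  have anti: "?d x y = - ?d y x" for x y
    using row_det_swap[of "[]" as k x y] assms(1) by simp
  have fct: "\<exists>f \<in> carrier_vec k. \<forall>x \<in> carrier_vec k. ?d x y = f \<bullet> x" for y
    using row_det_functional[of "y # as" k] assms(1) by (metis add_2_eq_Suc' length_Cons)
  obtain fb fc fy where f: "fb \<in> carrier_vec k" "fc \<in> carrier_vec k" "fy \<in> carrier_vec k"
    and d: "\<And>x. x \<in> carrier_vec k \<Longrightarrow> ?d x b = fb \<bullet> x"
      "\<And>x. x \<in> carrier_vec k \<Longrightarrow> ?d x c = fc \<bullet> x" "\<And>x. x \<in> carrier_vec k \<Longrightarrow> ?d x y = fy \<bullet> x"
    using fct[of b] fct[of c] fct[of y] by blast
  \<comment> \<open>Represents the difference of the two sides as a linear form in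
    \<open>x\<close>.\<close>
  define v where "v = ?d b c \<cdot>\<^sub>v fy + ?d y b \<cdot>\<^sub>v fc - ?d y c \<cdot>\<^sub>v fb"
  have v: "v \<bullet> x = ?d b c * ?d x y + ?d y b * ?d x c - ?d y c * ?d x b" if "x \<in> carrier_vec k" for x
    using that f unfolding v_def
    by (simp add: minus_scalar_prod_distrib[of _ k] add_scalar_prod_distrib[of _ k] d)
  have rep: "?d x y = 0" if "x \<in> carrier_vec k" "y \<in> carrier_vec k" "x = y \<or> x \<in> set as" for x y
    using that assms(1,2) by (intro row_det_repeat) auto
  have "v = 0\<^sub>v k"
  proof (rule orthogonal_to_basis_imp_zero[OF assms(7)])
    fix x assume "x \<in> set (b # c # as)"
    then consider "x = b" | "x = c" | "x \<in> set as" by auto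
    then show "v \<bullet> x = 0"
    proof cases
      case 1
      then show ?thesis using v[of b] rep[of b b] anti[of y b] assms by simp
    next
      case 2
      then show ?thesis using v[of c] rep[of c c] anti[of y c] anti[of c b] assms by simp
    next
      case 3
      then have "x \<in> carrier_vec k" using assms(2) by auto
      then show ?thesis using v[of x] rep[of x] 3 assms by simp
    qed
  qed (use assms f in \<open>auto simp: v_def\<close>)
  then have "v \<bullet> x = 0" using assms(3) by simp
  then show ?thesis using v[OF assms(3)] by (simp add: algebra_simps)
qed

section \<open>Arcs as indexed families in general position\<close>

text \<open>The condition is tested on every ordering of \<open>k\<close> indices, so that
  determinants may be formed with the rows in any order and the family may be reindexed by
  injections.\<close>

definition general_position :: "nat \<Rightarrow> 'i set \<Rightarrow> ('i \<Rightarrow> 'a::field vec) \<Rightarrow> bool" where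
  "general_position k I pt \<longleftrightarrow> pt ` I \<subseteq> carrier_vec k \<and>
     (\<forall>p. distinct p \<longrightarrow> set p \<subseteq> I \<longrightarrow> length p = k \<longrightarrow> row_det k (map pt p) \<noteq> 0)"

lemma nths_eq_map_sorted_list:
  assumes "I \<subseteq> {..<length xs}"
  shows "nths xs I = map ((!) xs) (sorted_list_of_set I)"
proof -
  have "nths xs I = map ((!) xs) (filter (\<lambda>i. i \<in> I) [0..<length xs])"
    by (induction xs rule: rev_induct) (auto simp: nths_append nth_append)
  also have "filter (\<lambda>i. i \<in> I) [0..<length xs] = sorted_list_of_set I"
    using assms finite_subset[OF assms]
    by (intro sorted_distinct_set_unique) (auto simp: sorted_wrt_filter)
  finally show ?thesis .
qed

lemma is_arc_iff_general_position:
  assumes "k \<ge> 1"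
  shows "is_arc k G \<longleftrightarrow> k \<le> length G \<and> general_position k {..<length G} ((!) G)"
proof
  assume arc: "is_arc k G"
  have basis: "row_det k (map ((!) G) p) \<noteq> 0 \<and> (\<forall>i \<in> set p. G ! i \<in> carrier_vec k)"
    if p: "distinct p" "set p \<subseteq> {..<length G}" "length p = k" for p
  proof -
    let ?n = "nths G (set p)"
    have "ordered_basis k ?n"
      using arc p by (simp add: is_arc_def distinct_card)
    moreover have n: "?n = map ((!) G) (sorted_list_of_set (set p))"
      using p by (intro nths_eq_map_sorted_list)
    then have "mset ?n = mset (map ((!) G) p)"
      using p by (metis mset_map mset_sorted_list_of_multiset sorted_list_of_mset_set mset_set_set)
    ultimately show ?thesis
      using row_det_permute_nonzero[of ?n "map ((!) G) p" k] n
      by (auto simp: ordered_basis_iff_row_det)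
  qed
  \<comment> \<open>The arc condition speaks about subfamilies of size \<open>k\<close> only; the
    vector at \<open>i\<close> lies in one of them because
    \<open>1 \<le> k \<le> length G\<close>.\<close>
  have "G ! i \<in> carrier_vec k" if i: "i < length G" for i
  proof -
    have "card ({..<length G} - {i}) \<ge> k - 1" using arc i by (simp add: is_arc_def diff_le_mono)
    then obtain J where J: "J \<subseteq> {..<length G} - {i}" "card J = k - 1" "finite J"
      by (meson obtain_subset_with_card_n)
    then have "distinct (i # sorted_list_of_set J)" "length (i # sorted_list_of_set J) = k"
      "set (i # sorted_list_of_set J) \<subseteq> {..<length G}" using i assms by auto
    then show ?thesis using basis by (metis list.set_intros(1))
  qed
  then show "k \<le> length G \<and> general_position k {..<length G} ((!) G)"
    using arc basis by (auto simp: general_position_def is_arc_def)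
next
  assume gp: "k \<le> length G \<and> general_position k {..<length G} ((!) G)"
  have "ordered_basis k (nths G I)" if I: "I \<subseteq> {..<length G}" "card I = k" for I
  proof -
    have "finite I" using I finite_subset by auto
    then show ?thesis
      using gp I by (auto simp: ordered_basis_iff_row_det general_position_def nths_eq_map_sorted_list)
  qed
  then show "is_arc k G" using gp by (auto simp: is_arc_def)
qed

lemma general_position_reindex:
  assumes "general_position k I pt" "inj_on f J" "f ` J \<subseteq> I"
  shows "general_position k J (\<lambda>j. pt (f j))"
  unfolding general_position_def
proof (intro conjI allI impI)
  show "(\<lambda>j. pt (f j)) ` J \<subseteq> carrier_vec k"
    using assms by (auto simp: general_position_def)
next
  fix p assume p: "distinct p" "set p \<subseteq> J" "length p = k"
  then have "distinct (map f p)" "set (map f p) \<subseteq> I"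
    using inj_on_subset[OF assms(2) p(2)] assms(3) by (auto simp: distinct_map)
  then have "row_det k (map pt (map f p)) \<noteq> 0"
    using assms(1) p(3) unfolding general_position_def by (metis length_map)
  then show "row_det k (map (\<lambda>j. pt (f j)) p) \<noteq> 0" by (simp add: comp_def)
qed

subsection \<open>A left null vector of the matrix M\<close>

definition sub_det :: "nat \<Rightarrow> (nat \<Rightarrow> 'a::field vec) \<Rightarrow> nat \<Rightarrow> nat set \<Rightarrow> 'a" where
  "sub_det k pt u C = row_det k (map pt (u # sorted_list_of_set C))"

lemma sub_det_nonzero:
  assumes "general_position k I pt" "finite C" "insert u C \<subseteq> I" "card C = k - 1" "u \<notin> C" "k \<ge> 1"
  shows "sub_det k pt u C \<noteq> 0"
proof -
  have "distinct (u # sorted_list_of_set C)" "set (u # sorted_list_of_set C) \<subseteq> I"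
    "length (u # sorted_list_of_set C) = k" using assms by auto
  then show ?thesis using assms(1) unfolding general_position_def sub_det_def by blast
qed

text \<open>
  With the values \<open>inverse (\<Prod>z \<in> I - C. sub_det k pt z C)\<close> in place of Ball's scaled tangent
  functions, the lemma of tangents reduces to the symmetry of the determinant; the signs that
  arise when \<open>a\<close> is sorted into \<open>A\<close> occur to the power \<open>CARD('a) + 1\<close> and cancel.
\<close>

lemma arc_kernel_identity:
  fixes pt :: "nat \<Rightarrow> 'a::{field,finite} vec"
  assumes gp: "general_position k I pt" and I: "finite I" "card I = CARD('a) + 1"
    and k: "2 \<le> k" "k \<le> CARD('a) + 1"
    and A: "A \<subseteq> I" "card A = k - 2" and E: "E \<subseteq> I - A" "card E = k"
  shows "(\<Sum>a\<in>E. inverse ((\<Prod>z\<in>I - insert a A. sub_det k pt z (insert a A)) *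
           (\<Prod>u\<in>E - {a}. sub_det k pt u (insert a A)))) = 0"
proof -
  let ?as = "map pt (sorted_list_of_set A)"
  let ?d = "\<lambda>x y. row_det k (pt x # pt y # ?as)"
  have finA: "finite A" using A I finite_subset by blast
  have card_IA: "card (I - A) = CARD('a) + 3 - k"
    using A I finA k by (simp add: card_Diff_subset)
  have nz: "?d x y \<noteq> 0" if "x \<in> I - A" "y \<in> I - A" "x \<noteq> y" for x y
  proof -
    have "distinct (x # y # sorted_list_of_set A)" "length (x # y # sorted_list_of_set A) = k"
      "set (x # y # sorted_list_of_set A) \<subseteq> I" using that A finA k by auto
    then have "row_det k (map pt (x # y # sorted_list_of_set A)) \<noteq> 0"
      using gp unfolding general_position_def by blast
    then show ?thesis by simp
  qed
  have carr: "pt x \<in> carrier_vec k" if "x \<in> I" for x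
    using gp that by (auto simp: general_position_def)
  have "2 \<le> card (I - A)" using card_IA k by simp
  then obtain X where "X \<subseteq> I - A" "card X = 2" by (meson obtain_subset_with_card_n)
  then obtain b c where bc: "b \<in> I - A" "c \<in> I - A" "b \<noteq> c" by (auto simp: card_2_iff)
  \<comment> \<open>Projection from \<open>A\<close> to the projective line, in the coordinates
    given by two further points \<open>b\<close> and \<open>c\<close>.\<close>
  define \<phi> where "\<phi> x = (?d x c, ?d x b)" for x
  have br: "bracket (\<phi> x) (\<phi> y) = - ?d b c * ?d x y" if "x \<in> I" "y \<in> I" for x y
  proof -
    have "length ?as + 2 = k" "set ?as \<subseteq> carrier_vec k" using A finA k carr by auto
    then show ?thesis
      using row_det_pluecker[of ?as k "pt x" "pt y" "pt b" "pt c"] that bc nz[of b c] carr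
      by (simp add: \<phi>_def bracket_def)
  qed
  have "\<exists>\<epsilon>. (\<epsilon> = 1 \<or> \<epsilon> = - 1) \<and> (\<forall>x. ?d x a = \<epsilon> * sub_det k pt x (insert a A))" if "a \<in> I - A" for a
  proof -
    have "mset (a # sorted_list_of_set A) = mset (sorted_list_of_set (insert a A))"
      using that finA by (simp flip: sorted_list_of_mset_set)
    then have "mset (pt a # ?as) = mset (map pt (sorted_list_of_set (insert a A)))"
      by (metis list.simps(9) mset_map)
    then obtain \<epsilon> where "\<epsilon> = 1 \<or> \<epsilon> = - 1" and
      \<epsilon>: "\<And>us. length us + length (pt a # ?as) = k \<Longrightarrow>
        row_det k (us @ pt a # ?as) = \<epsilon> * row_det k (us @ map pt (sorted_list_of_set (insert a A)))"
      by (rule row_det_permute[where k = k]) (rule that)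
    moreover have "?d x a = \<epsilon> * sub_det k pt x (insert a A)" for x
      using \<epsilon>[of "[pt x]"] k A by (simp add: sub_det_def)
    ultimately show ?thesis by blast
  qed
  then obtain \<epsilon> where \<epsilon>: "\<And>a. a \<in> I - A \<Longrightarrow> \<epsilon> a = 1 \<or> \<epsilon> a = - 1"
    and d_eq: "\<And>a x. a \<in> I - A \<Longrightarrow> ?d x a = \<epsilon> a * sub_det k pt x (insert a A)"
    by metis
  define \<eta> where "\<eta> a = - ?d b c * \<epsilon> a" for a
  have br': "bracket (\<phi> x) (\<phi> a) = \<eta> a * sub_det k pt x (insert a A)" if "x \<in> I" "a \<in> I - A" for x a
    using br[of x a] d_eq[of a x] that by (simp add: \<eta>_def)
  let ?s = "\<lambda>a. (\<Prod>z\<in>I - insert a A. sub_det k pt z (insert a A)) *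
           (\<Prod>u\<in>E - {a}. sub_det k pt u (insert a A))"
  have "(\<Sum>a\<in>E. inverse ((\<Prod>z\<in>I - A - {a}. bracket (\<phi> z) (\<phi> a)) *
           (\<Prod>u\<in>E - {a}. bracket (\<phi> u) (\<phi> a)))) = 0"
    using E I card_IA k br nz bc by (intro bracket_kernel_identity) auto
  moreover have "(\<Prod>z\<in>I - A - {a}. bracket (\<phi> z) (\<phi> a)) * (\<Prod>u\<in>E - {a}. bracket (\<phi> u) (\<phi> a))
      = (?d b c)\<^sup>2 * ?s a" if a: "a \<in> E" for a
  proof -
    have aIA: "a \<in> I - A" and finE: "finite E" using a E I finite_subset by auto
    have set_eq: "I - A - {a} = I - insert a A" by auto
    have card: "card (I - insert a A) = CARD('a) + 2 - k"
      using card_IA aIA I k by (simp flip: set_eq add: card_Diff_singleton)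
    have P1: "(\<Prod>z\<in>I - A - {a}. bracket (\<phi> z) (\<phi> a))
        = \<eta> a ^ (CARD('a) + 2 - k) * (\<Prod>z\<in>I - insert a A. sub_det k pt z (insert a A))"
      unfolding set_eq card[symmetric] prod_constant[symmetric] prod.distrib[symmetric]
      using aIA by (intro prod.cong) (auto simp: br')
    have P2: "(\<Prod>u\<in>E - {a}. bracket (\<phi> u) (\<phi> a))
        = \<eta> a ^ card (E - {a}) * (\<Prod>u\<in>E - {a}. sub_det k pt u (insert a A))"
      unfolding prod_constant[symmetric] prod.distrib[symmetric]
      using E aIA by (intro prod.cong) (auto simp: br')
    \<comment> \<open>The exponents add up to \<open>CARD('a) + 1\<close>, so this is the square of
      \<open>\<eta> a\<close>: the sign drops out and the rest does not depend on
      \<open>a\<close>.\<close>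
    have P3: "\<eta> a ^ (CARD('a) + 2 - k) * \<eta> a ^ card (E - {a}) = (?d b c)\<^sup>2"
    proof -
      have "CARD('a) + 2 - k + card (E - {a}) = Suc (CARD('a))"
        using a E finE k by simp
      then have "\<eta> a ^ (CARD('a) + 2 - k) * \<eta> a ^ card (E - {a}) = \<eta> a * \<eta> a"
        by (simp flip: power_add add: finite_field_power_card)
      then show ?thesis using \<epsilon>[OF aIA] by (auto simp: \<eta>_def power2_eq_square)
    qed
    show ?thesis unfolding P1 P2 P3[symmetric] by (simp only: mult_ac)
  qed
  ultimately have "(\<Sum>a\<in>E. inverse ((?d b c)\<^sup>2 * ?s a)) = 0" by simp
  then have "inverse ((?d b c)\<^sup>2) * (\<Sum>a\<in>E. inverse (?s a)) = 0"
    unfolding sum_distrib_left by (simp only: inverse_mult_distrib)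
  then show ?thesis using nz[OF bc] by simp
qed

section \<open>Colexicographic order of subsets\<close>

lemma colex_less_asym:
  assumes "finite A" "finite C" "colex_less A C"
  shows "\<not> colex_less C A"
  using assms colex_less_iff_set_encode_less[of A C] colex_less_iff_set_encode_less[of C A] by simp

text \<open>The maximum of the symmetric difference is at least \<open>c\<close>, hence above all of
  \<open>A - C\<close>, and so it lies in \<open>C\<close>.\<close>

lemma colex_lessI:
  assumes "finite A" "finite C" "c \<in> C - A" "\<And>x. x \<in> A - C \<Longrightarrow> x < c"
  shows "colex_less A C"
proof -
  have fin: "finite (sym_diff A C)" and c: "c \<in> sym_diff A C" using assms by auto
  have "Max (sym_diff A C) \<in> sym_diff A C" by (rule Max_in[OF fin]) (use c in blast)
  moreover have "c \<le> Max (sym_diff A C)" by (rule Max_ge[OF fin c])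
  ultimately have "Max (sym_diff A C) \<in> C" using assms(4) by (meson DiffD1 UnE not_le)
  then show ?thesis using assms(3) by (auto simp: colex_less_def)
qed

lemma colex_list_props:
  assumes "finite S" "\<And>A. A \<in> S \<Longrightarrow> finite A"
  shows "set (colex_list S) = S" "sorted_wrt colex_less (colex_list S)" "distinct (colex_list S)"
proof -
  have *: "set (colex_list S) = S \<and> sorted_wrt colex_less (colex_list S)"
    unfolding colex_list_def by (rule theI'[OF colex_list_unique[OF assms]])
  then show "set (colex_list S) = S" "sorted_wrt colex_less (colex_list S)" by auto
  have "colex_list S ! i \<noteq> colex_list S ! j" if "i < j" "j < length (colex_list S)" for i j
  proof -
    have "colex_less (colex_list S ! i) (colex_list S ! j)"
      using * that by (simp add: sorted_wrt_iff_nth_less)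
    then show ?thesis by (auto simp: colex_less_def)
  qed
  then show "distinct (colex_list S)"
    unfolding distinct_conv_nth by (metis nat_neq_iff)
qed

lemma subsets_of_size_finite:
  assumes "finite X"
  shows "finite (subsets_of_size X m)" "A \<in> subsets_of_size X m \<Longrightarrow> finite A"
  using assms finite_subset[of A X] by (auto simp: subsets_of_size_def)

lemma set_colex_list_subsets_of_size:
  "finite X \<Longrightarrow> set (colex_list (subsets_of_size X m)) = subsets_of_size X m"
  by (rule colex_list_props(1)) (auto intro: subsets_of_size_finite)

lemma sorted_wrt_filter_eq_take:
  assumes "sorted_wrt R xs" "\<And>x y. x \<in> set xs \<Longrightarrow> y \<in> set xs \<Longrightarrow> P x \<Longrightarrow> \<not> P y \<Longrightarrow> \<not> R y x"
  shows "filter P xs = take (length (filter P xs)) xs"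
  using assms
proof (induction xs)
  case (Cons x xs)
  show ?case
  proof (cases "P x")
    case True
    have "filter P xs = take (length (filter P xs)) xs"
      using Cons.prems by (intro Cons.IH) auto
    then show ?thesis using True by simp
  next
    case False
    then have "\<not> P y" if "y \<in> set xs" for y
      using Cons.prems that by fastforce
    then show ?thesis using False by simp
  qed
qed simp

text \<open>A set in the list that is not inside \<open>{..<k}\<close> has an element at least
  \<open>k\<close> and comes later. So the initial segment consists of the facets of the first
  \<open>k\<close> points, which are the rows where the vector of the hypothesis is 1.\<close>

lemma set_take_colex_list:
  assumes k: "1 \<le> k" "k \<le> N"
  shows "set (take k (colex_list (subsets_of_size {..<N} (k - 1)))) = (\<lambda>i. {..<k} - {i}) ` {..<k}"
proof -
  let ?S = "subsets_of_size {..<N} (k - 1)"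
  let ?xs = "colex_list ?S"
  let ?P = "\<lambda>A. A \<subseteq> {..<k}"
  note xs = colex_list_props[OF subsets_of_size_finite[OF finite_lessThan[of N]], of "k - 1"]
  have less: "colex_less A C" if AC: "A \<in> ?S" "C \<in> ?S" "?P A" "\<not> ?P C" for A C
  proof -
    obtain c where c: "c \<in> C" "\<not> c < k" using AC(4) by blast
    have "finite A" "finite C" using AC(1,2) subsets_of_size_finite[of "{..<N}"] by blast+
    then show ?thesis using c AC(3) by (intro colex_lessI[of _ _ c]) fastforce+
  qed
  have take: "filter ?P ?xs = take (length (filter ?P ?xs)) ?xs"
  proof (rule sorted_wrt_filter_eq_take[OF xs(2)])
    fix x y assume "x \<in> set ?xs" "y \<in> set ?xs" "?P x" "\<not> ?P y"
    then show "\<not> colex_less y x"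
      using less[of x y] colex_less_asym[of x y] subsets_of_size_finite[of "{..<N}"] xs(1) by auto
  qed
  have F: "{A \<in> ?S. ?P A} = (\<lambda>i. {..<k} - {i}) ` {..<k}"
  proof (intro equalityI subsetI)
    fix A assume "A \<in> {A \<in> ?S. ?P A}"
    then have A: "A \<subseteq> {..<k}" "card A = k - 1" "finite A"
      by (auto simp: subsets_of_size_def finite_subset)
    then have "card ({..<k} - A) = 1" using k by (simp add: card_Diff_subset)
    then obtain i where "{..<k} - A = {i}" by (auto simp: card_1_singleton_iff)
    then have "A = {..<k} - {i}" "i < k" using A(1) by auto
    then show "A \<in> (\<lambda>i. {..<k} - {i}) ` {..<k}" by auto
  qed (use k in \<open>auto simp: subsets_of_size_def\<close>)
  have "inj_on (\<lambda>i. {..<k} - {i}) {..<k}" by (auto simp: inj_on_def)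
  then have card: "card ((\<lambda>i. {..<k} - {i}) ` {..<k}) = k" by (simp add: card_image)
  have set_filter: "set (filter ?P ?xs) = (\<lambda>i. {..<k} - {i}) ` {..<k}"
    using F xs(1) by simp
  then have "length (filter ?P ?xs) = k"
    using distinct_card[of "filter ?P ?xs"] xs(3) card by simp
  then show ?thesis using take set_filter by simp
qed

text \<open>Any other set of size \<open>n\<close> misses one of the top \<open>n\<close> positions,
  which decides the comparison. The result is the same for every \<open>X\<close> containing these
  positions.\<close>

lemma last_colex_list:
  assumes "X \<subseteq> {..<N}" "{N - n..<N} \<subseteq> X" "n \<le> N"
  shows "last (colex_list (subsets_of_size X n)) = {N - n..<N}"
proof -
  let ?L = "{N - n..<N}" and ?S = "subsets_of_size X n"
  have finX: "finite X" using assms(1) finite_subset by auto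
  note xs = colex_list_props[OF subsets_of_size_finite[OF finX], of n]
  have L: "?L \<in> ?S" using assms by (auto simp: subsets_of_size_def)
  have less: "colex_less U ?L" if U: "U \<in> ?S" "U \<noteq> ?L" for U
  proof -
    have cU: "card U = n" "U \<subseteq> {..<N}" "finite U"
      using U subsets_of_size_finite(2)[OF finX U(1)] assms(1) by (auto simp: subsets_of_size_def)
    have "\<not> ?L \<subseteq> U"
      using card_subset_eq[of U ?L] cU U(2) assms(3) by auto
    then obtain l where l: "l \<in> ?L" "l \<notin> U" by blast
    show ?thesis using l cU by (intro colex_lessI[of _ _ l]) fastforce+
  qed
  have ne: "colex_list ?S \<noteq> []" using L xs(1) by force
  then obtain ys y where ys: "colex_list ?S = ys @ [y]" by (meson rev_exhaust)
  then have S: "?S = insert y (set ys)" using xs(1) by simp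
  have "y = ?L"
  proof (rule ccontr)
    assume neq: "y \<noteq> ?L"
    then have "?L \<in> set ys" using L S by auto
    then have "colex_less ?L y" using xs(2) by (simp add: ys sorted_wrt_append)
    moreover have "colex_less y ?L" "finite y"
      using less neq S subsets_of_size_finite(2)[OF finX, of y n] by auto
    ultimately show False using colex_less_asym[of y ?L] by simp
  qed
  then show ?thesis by (simp add: ys)
qed

text \<open>In the column \<open>(U, A)\<close> only the rows \<open>insert a A\<close> count, with
  \<open>a\<close> in the complement \<open>E\<close> of \<open>U\<close> and \<open>A\<close>; the
  size of the family makes \<open>card E = k\<close>. The entry cancels the factors of
  \<open>U\<close> from the second product of the weight, which leaves
  \<open>arc_kernel_identity\<close>.\<close>

lemma left_kernel_M:
  fixes pt :: "nat \<Rightarrow> 'a::{field,finite} vec" and k :: nat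
  defines "d \<equiv> sub_det k pt"
  assumes gp: "general_position k I pt" and I: "finite I" "card I = CARD('a) + 1"
    and k: "2 \<le> k" "k \<le> CARD('a) + 1" and N: "N = 2 * k - 2 + n" "{..<N} \<subseteq> I"
    and U: "U \<in> subsets_of_size {..<N} n" and A: "A \<in> subsets_of_size ({..<N} - U) (k - 2)"
  shows "(\<Sum>C\<in>subsets_of_size {..<N} (k - 1).
      inverse ((\<Prod>z\<in>I - C. d z C) * (\<Prod>y\<in>{..<N} - C. d y C)) *
      (if A \<subseteq> C \<and> C \<subseteq> {..<N} - U then \<Prod>u\<in>U. d u C else 0)) = 0"
    (is "(\<Sum>C\<in>?S. ?w C * ?m C) = 0")
proof -
  have U': "U \<subseteq> {..<N}" "card U = n" "finite U" and A': "A \<subseteq> {..<N} - U" "card A = k - 2" "finite A"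
    using U A by (auto simp: subsets_of_size_def finite_subset)
  define E where "E = {..<N} - U - A"
  have finE: "finite E" by (simp add: E_def)
  have cE: "card E = k"
    unfolding E_def using U' A' N k by (simp add: card_Diff_subset)
  have EI: "E \<subseteq> I - A" using N by (auto simp: E_def)
  let ?f = "\<lambda>a. insert a A"
  have img: "{C \<in> ?S. A \<subseteq> C \<and> C \<subseteq> {..<N} - U} = ?f ` E"
  proof (intro equalityI subsetI)
    fix C assume "C \<in> {C \<in> ?S. A \<subseteq> C \<and> C \<subseteq> {..<N} - U}"
    then have C: "card C = k - 1" "A \<subseteq> C" "C \<subseteq> {..<N} - U" "finite C"
      by (auto simp: subsets_of_size_def finite_subset)
    then have "card (C - A) = 1" using A' k by (simp add: card_Diff_subset)
    then obtain a where "C - A = {a}" by (auto simp: card_1_singleton_iff)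
    then have "C = insert a A" "a \<in> E" using C by (auto simp: E_def)
    then show "C \<in> ?f ` E" by auto
  next
    fix C assume "C \<in> ?f ` E"
    then show "C \<in> {C \<in> ?S. A \<subseteq> C \<and> C \<subseteq> {..<N} - U}"
      using A' k by (auto simp: E_def subsets_of_size_def)
  qed
  have inj: "inj_on ?f E" by (auto simp: inj_on_def E_def)
  have "(\<Sum>C\<in>?S. ?w C * ?m C) = (\<Sum>C\<in>{C \<in> ?S. A \<subseteq> C \<and> C \<subseteq> {..<N} - U}. ?w C * (\<Prod>u\<in>U. d u C))"
    by (rule sum.mono_neutral_cong_right) (auto simp: subsets_of_size_finite)
  also have "\<dots> = (\<Sum>a\<in>E. ?w (?f a) * (\<Prod>u\<in>U. d u (?f a)))"
    unfolding img by (subst sum.reindex[OF inj]) simp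
  also have "\<dots> = (\<Sum>a\<in>E. inverse ((\<Prod>z\<in>I - ?f a. d z (?f a)) * (\<Prod>u\<in>E - {a}. d u (?f a))))"
  proof (rule sum.cong[OF refl])
    fix a assume a: "a \<in> E"
    have "{..<N} - ?f a = U \<union> (E - {a})" using a U' A' by (auto simp: E_def)
    moreover have "U \<inter> (E - {a}) = {}" by (auto simp: E_def)
    ultimately have "(\<Prod>y\<in>{..<N} - ?f a. d y (?f a))
        = (\<Prod>u\<in>U. d u (?f a)) * (\<Prod>u\<in>E - {a}. d u (?f a))"
      using U'(3) finE by (simp add: prod.union_disjoint)
    moreover have "(\<Prod>u\<in>U. d u (?f a)) \<noteq> 0"
    proof -
      have "d u (?f a) \<noteq> 0" if "u \<in> U" for u
        unfolding d_def using that a U' A' N k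
        by (intro sub_det_nonzero[OF gp]) (auto simp: E_def)
      then show ?thesis using U' by simp
    qed
    ultimately show "?w (?f a) * (\<Prod>u\<in>U. d u (?f a))
        = inverse ((\<Prod>z\<in>I - ?f a. d z (?f a)) * (\<Prod>u\<in>E - {a}. d u (?f a)))"
      by (simp add: field_simps)
  qed
  also have "\<dots> = 0"
    unfolding d_def using A' N EI cE by (intro arc_kernel_identity[OF gp I k]) auto
  finally show ?thesis .
qed

text \<open>\<open>H\<close> is \<open>M\<close> with row \<open>C\<close> divided by
  \<open>L C\<close>, so \<open>w C * L C\<close> is a left null vector of \<open>H\<close>. Applied
  to a solution \<open>x\<close> of \<open>H x = v\<close> it leaves the first \<open>k\<close>
  rows. The family \<open>pt\<close> runs over the whole arc; its first \<open>N\<close> members are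
  the points of \<open>G\<close> in coordinates.\<close>

lemma column_space_first_rows:
  fixes G :: "'a::{field,finite} vec list"
  defines "N \<equiv> length G"
  assumes gp: "general_position k I pt" and I: "finite I" "card I = CARD('a) + 1"
    and k: "2 \<le> k" "k \<le> CARD('a) + 1" and N: "N = 2 * k - 2 + n" "{..<N} \<subseteq> I"
    and pt: "\<And>i. i < N \<Longrightarrow> pt i = coords k B (G ! i)"
    and v: "vec (N choose (k - 1)) (\<lambda>i. if i < k then 1 else 0) \<in> column_space (H_mat k B n G)"
  shows "(\<Sum>i<k. inverse ((\<Prod>z\<in>I - ({..<k} - {i}). sub_det k pt z ({..<k} - {i})) *
           (\<Prod>y\<in>{..<2 * k - 2} - ({..<k} - {i}). sub_det k pt y ({..<k} - {i})))) = 0"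
proof -
  let ?S = "subsets_of_size {..<N} (k - 1)"
  define xs where "xs = row_indices k G"
  define nr where "nr = length xs"
  define cs where "cs = col_indices k n G"
  define nc where "nc = length cs"
  define d where "d = sub_det k pt"
  define w where "w C = inverse ((\<Prod>z\<in>I - C. d z C) * (\<Prod>y\<in>{..<N} - C. d y C))" for C
  define L where "L C = (\<Prod>y\<in>last_set n G C. d y C)" for C
  note fin = subsets_of_size_finite[OF finite_lessThan[of N]]
  have xs: "set xs = ?S" "distinct xs"
    unfolding xs_def row_indices_def N_def[symmetric] using colex_list_props[OF fin] by auto
  have nr: "nr = N choose (k - 1)"
  proof -
    have "nr = card ?S" using xs unfolding nr_def by (metis distinct_card)
    then show ?thesis by (simp add: subsets_of_size_def n_subsets)
  qed
  have arc_det: "arc_det k B G u C = d u C" if "u < N" "C \<subseteq> {..<N}" for u C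
  proof -
    have "map (coords k B) (nths G C) = map pt (sorted_list_of_set C)"
      using that finite_subset[OF that(2)] pt
      by (auto simp: nths_eq_map_sorted_list N_def subset_iff)
    then show ?thesis using that(1) pt by (simp add: arc_det_def d_def sub_det_def row_det_def)
  qed
  have last_sub: "last_set n G C \<in> subsets_of_size ({..<N} - C) n" if "C \<in> ?S" for C
  proof -
    have C: "C \<subseteq> {..<N}" "card C = k - 1" "finite C"
      using that by (auto simp: subsets_of_size_def finite_subset)
    then have "n \<le> card ({..<N} - C)" using N k by (simp add: card_Diff_subset)
    then obtain X where "X \<subseteq> {..<N} - C" "card X = n" by (meson obtain_subset_with_card_n)
    then have "subsets_of_size ({..<N} - C) n \<noteq> {}" by (auto simp: subsets_of_size_def)
    moreover have "set (colex_list (subsets_of_size ({..<N} - C) n)) = subsets_of_size ({..<N} - C) n"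
      by (simp add: set_colex_list_subsets_of_size)
    ultimately show ?thesis unfolding last_set_def N_def[symmetric]
      by (metis last_in_set set_empty)
  qed
  have d_nz: "d y C \<noteq> 0" if "C \<in> ?S" "y \<in> I - C" for y C
    unfolding d_def using that N k
    by (intro sub_det_nonzero[OF gp]) (auto simp: subsets_of_size_def finite_subset)
  have L_nz: "L C \<noteq> 0" if C: "C \<in> ?S" for C
  proof -
    have "last_set n G C \<subseteq> I - C" "finite (last_set n G C)"
      using last_sub[OF C] N by (auto simp: subsets_of_size_def finite_subset)
    then show ?thesis using d_nz[OF C] by (auto simp: L_def)
  qed
  have J: "(\<Prod>y\<in>last_set n G C. inverse (arc_det k B G y C)) = inverse (L C)" if C: "C \<in> ?S" for C
  proof -
    have "(\<Prod>y\<in>last_set n G C. inverse (arc_det k B G y C)) = (\<Prod>y\<in>last_set n G C. inverse (d y C))"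
      using last_sub[OF C] C by (intro prod.cong) (auto simp: subsets_of_size_def arc_det subset_iff)
    then show ?thesis by (simp add: L_def prod_inversef[unfolded comp_def])
  qed
  define m where "m C UA = (if snd UA \<subseteq> C \<and> C \<subseteq> {..<N} - fst UA then \<Prod>u\<in>fst UA. d u C else 0)"
    for C and UA :: "nat set \<times> nat set"
  have cs: "fst (cs ! j) \<in> subsets_of_size {..<N} n"
      "snd (cs ! j) \<in> subsets_of_size ({..<N} - fst (cs ! j)) (k - 2)" if "j < nc" for j
  proof -
    have "cs ! j \<in> set cs" using that by (simp add: nc_def)
    then have "\<exists>U A. cs ! j = (U, A) \<and> U \<in> subsets_of_size {..<N} n \<and>
        A \<in> subsets_of_size ({..<N} - U) (k - 2)"
      unfolding cs_def col_indices_def N_def[symmetric]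
      by (auto simp: set_colex_list_subsets_of_size)
    then show "fst (cs ! j) \<in> subsets_of_size {..<N} n"
      "snd (cs ! j) \<in> subsets_of_size ({..<N} - fst (cs ! j)) (k - 2)" by auto
  qed
  have xs_in: "xs ! i \<in> ?S" if "i < nr" for i
    using that xs(1) by (metis nr_def nth_mem)
  have M: "M_mat k B n G $$ (i, j) = m (xs ! i) (cs ! j)" if "i < nr" "j < nc" for i j
  proof -
    have "(\<Prod>u\<in>fst (cs ! j). arc_det k B G u (xs ! i)) = (\<Prod>u\<in>fst (cs ! j). d u (xs ! i))"
      using cs(1)[OF that(2)] xs_in[OF that(1)]
      by (intro prod.cong) (auto simp: subsets_of_size_def arc_det subset_iff)
    then show ?thesis
      using that unfolding M_mat_def m_def xs_def[symmetric] cs_def[symmetric] N_def[symmetric]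
        nr_def[symmetric] nc_def[symmetric]
      by (auto simp: Let_def case_prod_beta)
  qed
  have dimH: "H_mat k B n G \<in> carrier_mat nr nc"
    by (simp add: H_mat_def J_mat_def M_mat_def nr_def nc_def xs_def cs_def carrier_matI)
  have H: "H_mat k B n G $$ (i, j) = inverse (L (xs ! i)) * m (xs ! i) (cs ! j)"
    if ij: "i < nr" "j < nc" for i j
  proof -
    have dims: "J_mat k B n G \<in> carrier_mat nr nr" "M_mat k B n G \<in> carrier_mat nr nc"
      by (auto simp: J_mat_def M_mat_def nr_def nc_def xs_def cs_def)
    have "H_mat k B n G $$ (i, j) = (\<Sum>l<nr. J_mat k B n G $$ (i, l) * M_mat k B n G $$ (l, j))"
      using dims ij by (simp add: H_mat_def scalar_prod_def atLeast0LessThan)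
    also have "\<dots> = (\<Sum>l<nr. if l = i then inverse (L (xs ! i)) * m (xs ! i) (cs ! j) else 0)"
      using ij xs_in J M
      by (intro sum.cong) (auto simp: J_mat_def Let_def nr_def xs_def)
    finally show ?thesis using ij by simp
  qed
  obtain x where x: "x \<in> carrier_vec nc"
    "H_mat k B n G *\<^sub>v x = vec nr (\<lambda>i. if i < k then 1 else 0)"
  proof -
    interpret vec_space "TYPE('a)" nr .
    show thesis using v that dimH col_space_eq[OF dimH]
      by (auto simp: column_space_def nr)
  qed
  have Hx: "(\<Sum>j<nc. inverse (L (xs ! i)) * m (xs ! i) (cs ! j) * x $ j) = (if i < k then 1 else 0)"
    if i: "i < nr" for i
  proof -
    have "(H_mat k B n G *\<^sub>v x) $ i = (\<Sum>j<nc. H_mat k B n G $$ (i, j) * x $ j)"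
      using i dimH x(1) by (simp add: scalar_prod_def atLeast0LessThan)
    then show ?thesis using x(2) i H by simp
  qed
  have kN: "k \<le> N" using N k by simp
  have "k \<le> nr"
  proof -
    have "inj_on (\<lambda>i. {..<k} - {i}) {..<k}" by (auto simp: inj_on_def)
    then have "k = card ((\<lambda>i. {..<k} - {i}) ` {..<k})" by (simp add: card_image)
    also have "\<dots> \<le> card ?S" using kN by (intro card_mono fin) (auto simp: subsets_of_size_def)
    finally show ?thesis using xs by (metis distinct_card nr_def)
  qed
  have "0 = (\<Sum>j<nc. x $ j * (\<Sum>C\<in>?S. w C * m C (cs ! j)))"
    unfolding w_def m_def d_def
    using left_kernel_M[OF gp I k N cs] by simp
  also have "\<dots> = (\<Sum>j<nc. x $ j * (\<Sum>i<nr. w (xs ! i) * m (xs ! i) (cs ! j)))"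
    unfolding xs(1)[symmetric] sum.distinct_set_conv_list[OF xs(2)] nr_def
    by (simp add: sum_list_sum_nth atLeast0LessThan)
  also have "\<dots> = (\<Sum>i<nr. w (xs ! i) * (\<Sum>j<nc. m (xs ! i) (cs ! j) * x $ j))"
    unfolding sum_distrib_left by (subst sum.swap) (simp add: mult_ac)
  also have "\<dots> = (\<Sum>i<nr. if i < k then w (xs ! i) * L (xs ! i) else 0)"
  proof (rule sum.cong[OF refl])
    fix i assume i: "i \<in> {..<nr}"
    have "(\<Sum>j<nc. m (xs ! i) (cs ! j) * x $ j) = L (xs ! i) * (if i < k then 1 else 0)"
      using L_nz[OF xs_in, of i] i
      by (simp flip: Hx add: sum_distrib_left mult.assoc[symmetric])
    then show "w (xs ! i) * (\<Sum>j<nc. m (xs ! i) (cs ! j) * x $ j)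
        = (if i < k then w (xs ! i) * L (xs ! i) else 0)" by simp
  qed
  also have "\<dots> = (\<Sum>i<k. w (xs ! i) * L (xs ! i))"
    using \<open>k \<le> nr\<close> by (intro sum.mono_neutral_cong_right) auto
  also have "\<dots> = (\<Sum>C\<in>set (take k xs). w C * L C)"
    using \<open>k \<le> nr\<close> xs(2) unfolding sum.distinct_set_conv_list[OF distinct_take[OF xs(2)]]
    by (simp add: sum_list_sum_nth atLeast0LessThan nr_def)
  also have "set (take k xs) = (\<lambda>i. {..<k} - {i}) ` {..<k}"
    unfolding xs_def row_indices_def N_def[symmetric] using k kN by (intro set_take_colex_list) auto
  also have "(\<Sum>C\<in>(\<lambda>i. {..<k} - {i}) ` {..<k}. w C * L C)
      = (\<Sum>i<k. w ({..<k} - {i}) * L ({..<k} - {i}))"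
    by (subst sum.reindex) (auto simp: inj_on_def)
  also have "\<dots> = (\<Sum>i<k. inverse ((\<Prod>z\<in>I - ({..<k} - {i}). d z ({..<k} - {i})) *
      (\<Prod>y\<in>{..<2 * k - 2} - ({..<k} - {i}). d y ({..<k} - {i}))))"
  proof (rule sum.cong[OF refl])
    fix i assume i: "i \<in> {..<k}"
    let ?C = "{..<k} - {i}"
    have CS: "?C \<in> ?S" using i kN by (auto simp: subsets_of_size_def)
    \<comment> \<open>The first \<open>k\<close> rows avoid the last \<open>n\<close> positions, as
      \<open>k \<le> 2 * k - 2\<close>. So \<open>last_set\<close> is the same for each of them, and
      its factors cancel from \<open>w ?C * L ?C\<close>.\<close>
    have last: "last_set n G ?C = {N - n..<N}"
      unfolding last_set_def N_def[symmetric] using N k by (intro last_colex_list) auto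
    have split: "{..<N} - ?C = ({..<2 * k - 2} - ?C) \<union> {N - n..<N}"
      using N k by auto
    have "(\<Prod>y\<in>{..<N} - ?C. d y ?C) = (\<Prod>y\<in>{..<2 * k - 2} - ?C. d y ?C) * L ?C"
      unfolding L_def last split using N(1) by (intro prod.union_disjoint) auto
    then show "w ?C * L ?C = inverse ((\<Prod>z\<in>I - ?C. d z ?C) * (\<Prod>y\<in>{..<2 * k - 2} - ?C. d y ?C))"
      using L_nz[OF CS] by (simp add: w_def field_simps)
  qed
  finally show ?thesis by (simp add: d_def)
qed

subsection \<open>Row and column operations\<close>

lemma equiv_steps_eliminate_entries_rec:
  assumes "I < dim_row X" "\<And>a i. (a, i) \<in> set ais \<Longrightarrow> i < dim_row X \<and> i \<noteq> I"
  shows "equiv_step\<^sup>*\<^sup>* X (eliminate_entries_rec X I ais)"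
  using assms
proof (induction ais arbitrary: X)
  case (Cons ai ais)
  obtain a i where ai: "ai = (a, i)" by force
  have "equiv_step X (addrow a i I X)"
    using Cons.prems(1) Cons.prems(2)[of a i] by (intro equiv_step.add_row) (auto simp: ai)
  moreover have "equiv_step\<^sup>*\<^sup>* (addrow a i I X) (eliminate_entries_rec (addrow a i I X) I ais)"
    using Cons.prems by (intro Cons.IH) auto
  ultimately show ?case by (simp add: ai)
qed simp

text \<open>The elimination is steered by \<open>A\<close> alone and repeats every operation on
  \<open>X\<close>, so its recursion consists of swaps, scalings and additions of rows of
  \<open>X\<close>.\<close>

lemma equiv_steps_gauss_jordan_main:
  assumes "dim_row X = dim_row A"
  shows "equiv_step\<^sup>*\<^sup>* X (snd (gauss_jordan_main A X i j))"
  using assms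
proof (induction A X i j rule: gauss_jordan_main.induct)
  case (1 A X i j)
  note dim = "1.prems"
  show ?case
  proof (cases "i < dim_row A \<and> j < dim_col A")
    case False
    then show ?thesis by (subst gauss_jordan_main.simps) auto
  next
    case ij: True
    let ?L = "[i'. i' <- [Suc i..<dim_row A], A $$ (i', j) \<noteq> 0]"
    consider "A $$ (i, j) = 0" "?L = []" | i' L where "A $$ (i, j) = 0" "?L = i' # L"
      | "A $$ (i, j) = 1" | "A $$ (i, j) \<noteq> 0" "A $$ (i, j) \<noteq> 1"
      by (cases ?L) auto
    then show ?thesis
    proof cases
      case 1
      show ?thesis
        using "1.IH"(1)[OF refl refl ij refl 1] dim ij 1(1)
        by (subst gauss_jordan_main.simps) (simp add: 1(2) del: concat_eq_Nil_conv)
    next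
      case (2 i' L)
      have "i' \<in> set ?L" using 2 by simp
      then have "i' < dim_row A" by auto
      then have "equiv_step X (swaprows i i' X)"
        using ij dim by (intro equiv_step.swap_rows) auto
      moreover have "equiv_step\<^sup>*\<^sup>* (swaprows i i' X)
          (snd (gauss_jordan_main (swaprows i i' A) (swaprows i i' X) i j))"
        using "1.IH"(2)[OF refl refl ij refl 2] dim by auto
      ultimately show ?thesis using 2 ij by (subst gauss_jordan_main.simps) auto
    next
      case 3
      let ?v = "\<lambda>i. A $$ (i, j)"
      have "equiv_step\<^sup>*\<^sup>* X (eliminate_entries ?v X i j)"
        using ij dim by (subst eliminate_entries_convert)
          (auto intro!: equiv_steps_eliminate_entries_rec)
      moreover have "equiv_step\<^sup>*\<^sup>* (eliminate_entries ?v X i j)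
          (snd (gauss_jordan_main (eliminate_entries ?v A i j) (eliminate_entries ?v X i j)
             (Suc i) (Suc j)))"
        using "1.IH"(3)[OF refl refl ij refl _ 3 refl] 3 dim by auto
      ultimately show ?thesis using 3 ij by (subst gauss_jordan_main.simps) (auto simp: Let_def)
    next
      case 4
      let ?c = "inverse (A $$ (i, j))"
      have "equiv_step X (multrow i ?c X)"
        using ij dim 4 by (intro equiv_step.scale_row) auto
      moreover have "equiv_step\<^sup>*\<^sup>* (multrow i ?c X)
          (snd (gauss_jordan_main (multrow i ?c A) (multrow i ?c X) i j))"
        using "1.IH"(4)[OF refl refl ij refl 4 refl] dim by auto
      ultimately show ?thesis using 4 ij by (subst gauss_jordan_main.simps) (auto simp: Let_def)
    qed
  qed
qed

lemma inverse_mat_exists: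
  fixes A :: "'a::field mat"
  assumes "A \<in> carrier_mat k k" "det A \<noteq> 0"
  obtains A' where "A' \<in> carrier_mat k k" "A * A' = 1\<^sub>m k" "A' * A = 1\<^sub>m k"
  using det_non_zero_imp_unit[OF assms, of "()"] unfolding Units_def ring_mat_def by auto

text \<open>Elimination reduces the inverse of \<open>T\<close> to the identity, so its operations
  amount to multiplication by \<open>T\<close>; the same operations are carried out on
  \<open>X\<close>.\<close>

lemma equiv_steps_mult_left:
  fixes T :: "'a::field mat"
  assumes T: "T \<in> carrier_mat k k" "det T \<noteq> 0" and X: "X \<in> carrier_mat k m"
  shows "equiv_step\<^sup>*\<^sup>* X (T * X)"
proof -
  obtain A where A: "A \<in> carrier_mat k k" "T * A = 1\<^sub>m k" "A * T = 1\<^sub>m k"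
    using inverse_mat_exists[OF T] .
  obtain A' X' where gj: "gauss_jordan A X = (A', X')" by force
  have "A \<in> Units (ring_mat TYPE('a) k ())"
    using A T unfolding Units_def ring_mat_def by auto
  from gauss_jordan_inverse_other_direction[OF this X] gj have A': "A' = 1\<^sub>m k" by simp
  obtain P where P: "P \<in> Units (ring_mat TYPE('a) k ())" "A' = P * A" "X' = P * X"
    using gauss_jordan_transform[OF A(1) X gj, of "()"] by auto
  have Pc: "P \<in> carrier_mat k k" using P unfolding Units_def ring_mat_def by auto
  have "P = P * (A * T)" using Pc A by simp
  also have "\<dots> = (P * A) * T" using Pc A T by (simp add: assoc_mult_mat[of _ k k _ k _ k])
  also have "\<dots> = T" using T by (simp flip: P(2) add: A')
  finally have "X' = T * X" using P by simp
  then show ?thesis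
    using equiv_steps_gauss_jordan_main[of X A 0 0] A X gj by (simp add: gauss_jordan_def)
qed

lemma equiv_steps_scale_cols:
  fixes X :: "'a::field mat"
  assumes "X \<in> carrier_mat k m" "\<And>j. j < m \<Longrightarrow> s j \<noteq> 0" "l \<le> m"
  shows "equiv_step\<^sup>*\<^sup>* X (mat k m (\<lambda>(i, j). if j < l then s j * X $$ (i, j) else X $$ (i, j)))"
    (is "equiv_step\<^sup>*\<^sup>* X (?S l)")
  using assms(3)
proof (induction l)
  case 0
  have "?S 0 = X" using assms(1) by (intro eq_matI) auto
  then show ?case by simp
next
  case (Suc l)
  have "equiv_step (?S l) (multcol l (s l) (?S l))"
    using Suc.prems assms(2) by (intro equiv_step.scale_col) auto
  also have "multcol l (s l) (?S l) = ?S (Suc l)"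
    by (rule eq_matI) (auto simp: less_Suc_eq)
  finally show ?case using Suc by (meson Suc_leD rtranclp.rtrancl_into_rtrancl)
qed

text \<open>\<open>X\<close> has its columns permuted and scaled and is then multiplied by the
  inverse of \<open>Q\<close> times \<open>T\<close>. Separate matrices \<open>T\<close> and
  \<open>Q\<close> let two families be compared in a third coordinate system.\<close>

lemma equiv_steps_columnwise:
  fixes X Y :: "'a::field mat"
  assumes T: "T \<in> carrier_mat k k" "det T \<noteq> 0" and Q: "Q \<in> carrier_mat k k" "det Q \<noteq> 0"
    and X: "X \<in> carrier_mat k m" and Y: "Y \<in> carrier_mat k m"
    and \<pi>: "\<pi> permutes {..<m}" and s: "\<And>j. j < m \<Longrightarrow> s j \<noteq> 0"
    and eq: "\<And>j. j < m \<Longrightarrow> Q *\<^sub>v col Y j = s j \<cdot>\<^sub>v (T *\<^sub>v col X (\<pi> j))"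
  shows "equiv_step\<^sup>*\<^sup>* X Y"
proof -
  define X1 where "X1 = mat k m (\<lambda>(i, j). X $$ (i, \<pi> j))"
  define X2 where "X2 = mat k m (\<lambda>(i, j). s j * X1 $$ (i, j))"
  have carr: "X1 \<in> carrier_mat k m" "X2 \<in> carrier_mat k m"
    by (auto simp: X1_def X2_def)
  have "equiv_step X X1"
    using equiv_step.permute_cols[of \<pi> X] \<pi> X by (simp add: X1_def)
  also have "X2 = mat k m (\<lambda>(i, j). if j < m then s j * X1 $$ (i, j) else X1 $$ (i, j))"
    by (rule eq_matI) (auto simp: X2_def)
  then have "equiv_step\<^sup>*\<^sup>* X1 X2"
    using equiv_steps_scale_cols[OF carr(1), of s m] s by simp
  also obtain Q' where Q': "Q' \<in> carrier_mat k k" "Q * Q' = 1\<^sub>m k" "Q' * Q = 1\<^sub>m k"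
    using inverse_mat_exists[OF Q] .
  have "det Q' \<noteq> 0" using det_mult[OF Q(1) Q'(1)] Q'(2) by auto
  then have "equiv_step\<^sup>*\<^sup>* X2 ((Q' * T) * X2)"
    using Q'(1) T carr by (intro equiv_steps_mult_left) (auto simp: det_mult)
  also have "(Q' * T) * X2 = Q' * (T * X2)"
    using Q'(1) T carr by simp
  also have "T * X2 = Q * Y"
  proof (rule mat_col_eqI)
    fix j assume "j < dim_col (Q * Y)"
    then have j: "j < m" using Y by simp
    have \<pi>j: "\<pi> j < m" using permutes_in_image[OF \<pi>, of j] j by simp
    have col_X2: "col X2 j = s j \<cdot>\<^sub>v col X (\<pi> j)"
      using j \<pi>j X by (intro eq_vecI) (auto simp: X1_def X2_def)
    have "col (T * X2) j = T *\<^sub>v col X2 j" by (rule col_mult2[OF T(1) carr(2) j])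
    also have "\<dots> = s j \<cdot>\<^sub>v (T *\<^sub>v col X (\<pi> j))"
      using X \<pi>j by (simp only: col_X2 mult_mat_vec[OF T(1) col_carrier_vec[OF \<pi>j X]])
    also have "\<dots> = Q *\<^sub>v col Y j" by (rule eq[OF j, symmetric])
    also have "\<dots> = col (Q * Y) j" by (rule col_mult2[OF Q(1) Y j, symmetric])
    finally show "col (T * X2) j = col (Q * Y) j" .
  qed (use T Q Y carr in auto)
  also have "Q' * (Q * Y) = Y"
    using Q' Q Y by (simp flip: assoc_mult_mat[of _ k k _ k _ m])
  finally show ?thesis .
qed

subsection \<open>The identity in coordinates\<close>

lemma coords_props:
  fixes B :: "'a::field vec list"
  assumes "ordered_basis k B" "u \<in> carrier_vec k"
  shows "coords k B u \<in> carrier_vec k" "mat_of_cols k B *\<^sub>v coords k B u = u"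
proof -
  let ?M = "mat_of_cols k B"
  have B: "length B = k" "row_det k B \<noteq> 0" using assms(1) by (auto simp: ordered_basis_iff_row_det)
  then have M: "?M \<in> carrier_mat k k" "det ?M \<noteq> 0"
    using row_det_eq_det_cols[of B k] by auto
  obtain M' where M': "M' \<in> carrier_mat k k" "?M * M' = 1\<^sub>m k" "M' * ?M = 1\<^sub>m k"
    using inverse_mat_exists[OF M] .
  have "\<exists>!c. c \<in> carrier_vec k \<and> ?M *\<^sub>v c = u"
  proof (rule ex1I[of _ "M' *\<^sub>v u"])
    show "M' *\<^sub>v u \<in> carrier_vec k \<and> ?M *\<^sub>v (M' *\<^sub>v u) = u"
      using M M' assms(2) by (simp flip: assoc_mult_mat_vec[of _ k k _ k])
  next
    fix c assume "c \<in> carrier_vec k \<and> ?M *\<^sub>v c = u"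
    then show "c = M' *\<^sub>v u"
      using M M' by (metis assoc_mult_mat_vec one_mult_mat_vec)
  qed
  then have "coords k B u \<in> carrier_vec k \<and> ?M *\<^sub>v coords k B u = u"
    unfolding coords_def by (rule theI')
  then show "coords k B u \<in> carrier_vec k" "?M *\<^sub>v coords k B u = u" by auto
qed

lemma general_position_coords:
  fixes B :: "'a::field vec list"
  assumes B: "ordered_basis k B" and gp: "general_position k I pt"
  shows "general_position k I (\<lambda>i. coords k B (pt i))"
  unfolding general_position_def
proof (intro conjI allI impI)
  show "(\<lambda>i. coords k B (pt i)) ` I \<subseteq> carrier_vec k"
    using gp coords_props[OF B] by (auto simp: general_position_def)
next
  fix p assume p: "distinct p" "set p \<subseteq> I" "length p = k"
  have Bk: "mat_of_cols k B \<in> carrier_mat k k" using B by (auto simp: ordered_basis_iff_row_det)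
  let ?X = "mat_of_cols k (map (\<lambda>i. coords k B (pt i)) p)"
  have carr: "pt (p ! j) \<in> carrier_vec k" if "j < k" for j
  proof -
    have "p ! j \<in> I" using p that by (metis nth_mem subsetD)
    then show ?thesis using gp by (auto simp: general_position_def)
  qed
  have "mat_of_cols k (map pt p) = mat_of_cols k B * ?X"
  proof (rule mat_col_eqI)
    fix j assume "j < dim_col (mat_of_cols k B * ?X)"
    then have j: "j < k" using p by simp
    then show "col (mat_of_cols k (map pt p)) j = col (mat_of_cols k B * ?X) j"
      using p carr[OF j] coords_props[OF B carr[OF j]] Bk
      by (subst col_mult2[OF Bk, of _ k]) (auto simp: carrier_matI)
  qed (use p Bk in auto)
  moreover have "det (mat_of_cols k (map pt p)) \<noteq> 0"
    using gp p row_det_eq_det_cols[of "map pt p" k]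
    unfolding general_position_def by (metis length_map)
  moreover have "?X \<in> carrier_mat k k" using p by (simp add: carrier_matI)
  ultimately have "det ?X \<noteq> 0" using det_mult[OF Bk] by auto
  then show "row_det k (map (\<lambda>i. coords k B (pt i)) p) \<noteq> 0"
    using p by (simp add: row_det_eq_det_cols)
qed

lemma general_position_cong:
  assumes "general_position k I pt" "\<And>i. i \<in> I \<Longrightarrow> pt i = pt' i"
  shows "general_position k I pt'"
proof -
  have "map pt' p = map pt p" if "set p \<subseteq> I" for p
    using that assms(2) by (metis map_eq_conv subsetD)
  moreover have "pt' ` I = pt ` I" using assms(2) by (metis image_cong)
  ultimately show ?thesis using assms(1) unfolding general_position_def by metis
qed

text \<open>As a function of \<open>u\<close>, this is a linear form vanishing at the first
  \<open>k\<close> points other than \<open>i\<close>. In general position it is, up to a nonzero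
  factor, the \<open>i\<close>-th coordinate with respect to the basis of the first \<open>k\<close>
  points.\<close>

definition facet_det :: "nat \<Rightarrow> (nat \<Rightarrow> 'a::field vec) \<Rightarrow> nat \<Rightarrow> nat \<Rightarrow> 'a" where
  "facet_det k pt i u = sub_det k pt u ({..<k} - {i})"

text \<open>The hypothesis of the theorem singles out initial positions of a list; this moves any
  set \<open>Y\<close> of later points right behind the first \<open>k\<close>, which stay
  fixed.\<close>

lemma exists_reordering:
  assumes "Y \<subseteq> {k..<m}" "card Y = l" "k + l \<le> m"
  obtains f where "bij_betw f {..<m} {..<m}" "\<And>j. j < k \<Longrightarrow> f j = j" "bij_betw f {k..<k + l} Y"
    "bij_betw f {k..<m} {k..<m}"
proof -
  have finY: "finite Y" using assms(1) finite_subset by blast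
  obtain g where g: "bij_betw g {k..<k + l} Y"
    using finite_same_card_bij[of "{k..<k + l}" Y] finY assms(2) by auto
  have "card {k + l..<m} = card ({k..<m} - Y)"
    using assms finY by (simp add: card_Diff_subset)
  then obtain h where h: "bij_betw h {k + l..<m} ({k..<m} - Y)"
    using finite_same_card_bij[of "{k + l..<m}" "{k..<m} - Y"] by auto
  define f where "f j = (if j < k then j else if j < k + l then g j else h j)" for j
  have fg: "bij_betw f {k..<k + l} Y"
    using g by (subst bij_betw_cong[of _ f g]) (auto simp: f_def)
  have "bij_betw f {k + l..<m} ({k..<m} - Y)"
    using h by (subst bij_betw_cong[of _ f h]) (auto simp: f_def)
  from bij_betw_combine[OF fg this] have "bij_betw f ({k..<k + l} \<union> {k + l..<m}) (Y \<union> ({k..<m} - Y))"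
    by auto
  also have "{k..<k + l} \<union> {k + l..<m} = {k..<m}" using assms(3) by auto
  also have "Y \<union> ({k..<m} - Y) = {k..<m}" using assms(1) by auto
  finally have fkm: "bij_betw f {k..<m} {k..<m}" .
  have "bij_betw f {..<k} {..<k}"
    by (subst bij_betw_cong[of _ f id]) (auto simp: f_def)
  from this fkm have "bij_betw f ({..<k} \<union> {k..<m}) ({..<k} \<union> {k..<m})"
    by (rule bij_betw_combine) auto
  also have "{..<k} \<union> {k..<m} = {..<m}" using assms(3) by auto
  finally have fm: "bij_betw f {..<m} {..<m}" .
  show thesis by (rule that[OF fm _ fg fkm]) (simp add: f_def)
qed

text \<open>The arc is reordered before \<open>column_space_first_rows\<close> is applied. Of the
  two products there, the first runs over all points off a facet and is the same for every order,
  while the second consists of \<open>i\<close> and \<open>Y\<close>; hence the coefficients do not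
  depend on \<open>Y\<close>.\<close>

lemma arc_power_identity:
  fixes S B :: "'a::{field,finite} vec list" and k n :: nat
  defines "pt \<equiv> \<lambda>i. coords k B (S ! i)" and "m \<equiv> CARD('a) + 1"
  assumes k: "2 \<le> k" and n: "n + 2 * k \<le> CARD('a)" and B: "ordered_basis k B"
    and hyp: "\<And>G :: 'a vec list. is_arc k G \<Longrightarrow> length G = 2 * k - 2 + n \<Longrightarrow>
      vec ((2 * k - 2 + n) choose (k - 1)) (\<lambda>i. if i < k then 1 else 0)
        \<in> column_space (H_mat k B n G)"
    and S: "is_arc k S" "length S = m" and Y: "Y \<subseteq> {k..<m}" "card Y = k - 2"
  shows "(\<Sum>i<k. inverse ((\<Prod>z\<in>{..<m} - ({..<k} - {i}). facet_det k pt i z) * facet_det k pt i i)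
    * (\<Prod>y\<in>Y. inverse (facet_det k pt i y))) = 0"
proof -
  have km: "k + (k - 2) \<le> m" using k n by (simp add: m_def)
  obtain f where f: "bij_betw f {..<m} {..<m}" "\<And>j. j < k \<Longrightarrow> f j = j"
    "bij_betw f {k..<k + (k - 2)} Y" "bij_betw f {k..<m} {k..<m}"
    by (rule exists_reordering[OF Y km]) (rule that)
  define N where "N = 2 * k - 2 + n"
  have Nm: "N \<le> m" using n k by (simp add: N_def m_def)
  \<comment> \<open>The first \<open>k\<close> points stay in place, those of \<open>Y\<close> come
    next, and \<open>n\<close> arbitrary further points follow.\<close>
  define G where "G = map (\<lambda>i. S ! f i) [0..<N]"
  define pt' where "pt' i = pt (f i)" for i
  have gpS: "general_position k {..<m} ((!) S)"
    using S k is_arc_iff_general_position[of k S] by auto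
  have injf: "inj_on f {..<m}" and imgf: "f ` {..<m} = {..<m}"
    using f(1) by (auto simp: bij_betw_def)
  have sub: "{..<N} \<subseteq> {..<m}" using Nm by auto
  have "f ` {..<N} \<subseteq> {..<m}" using image_mono[OF sub, of f] by (simp only: imgf)
  then have "general_position k {..<N} (\<lambda>i. S ! f i)"
    by (rule general_position_reindex[OF gpS inj_on_subset[OF injf sub]])
  then have "general_position k {..<N} ((!) G)"
    by (rule general_position_cong) (simp add: G_def)
  moreover have lenG: "length G = N" by (simp add: G_def)
  moreover have "1 \<le> k" "k \<le> N" using k by (auto simp: N_def)
  ultimately have "is_arc k G" by (simp only: is_arc_iff_general_position)
  from hyp[OF this] have v: "vec (N choose (k - 1)) (\<lambda>i. if i < k then 1 else 0)
      \<in> column_space (H_mat k B n G)" using lenG unfolding N_def by blast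
  have gp': "general_position k {..<m} pt'"
    using general_position_reindex[OF general_position_coords[OF B gpS] injf] imgf
    by (simp add: pt'_def[abs_def] pt_def)
  have d': "sub_det k pt' z ({..<k} - {i}) = facet_det k pt i (f z)" for z i
  proof -
    have "map pt' (sorted_list_of_set ({..<k} - {i})) = map pt (sorted_list_of_set ({..<k} - {i}))"
      using f(2) by (auto simp: pt'_def)
    then show ?thesis by (simp only: sub_det_def facet_det_def list.map pt'_def)
  qed
  have "(\<Sum>i<k. inverse ((\<Prod>z\<in>{..<m} - ({..<k} - {i}). facet_det k pt i (f z)) *
           (\<Prod>y\<in>{..<2 * k - 2} - ({..<k} - {i}). facet_det k pt i (f y)))) = 0"
    unfolding d'[symmetric]
  proof (rule column_space_first_rows[OF gp'])
    show "{..<length G} \<subseteq> {..<m}" using lenG sub by simp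
    show "length G = 2 * k - 2 + n" using lenG by (simp only: N_def)
    show "pt' i = coords k B (G ! i)" if "i < length G" for i
      using that lenG by (simp add: pt'_def pt_def G_def)
    show "vec (length G choose (k - 1)) (\<lambda>i. if i < k then 1 else 0) \<in> column_space (H_mat k B n G)"
      using v lenG by simp
  qed (use k n in \<open>auto simp: m_def\<close>)
  also have "(\<Sum>i<k. inverse ((\<Prod>z\<in>{..<m} - ({..<k} - {i}). facet_det k pt i (f z)) *
           (\<Prod>y\<in>{..<2 * k - 2} - ({..<k} - {i}). facet_det k pt i (f y))))
      = (\<Sum>i<k. inverse ((\<Prod>z\<in>{..<m} - ({..<k} - {i}). facet_det k pt i z) * facet_det k pt i i)
    * (\<Prod>y\<in>Y. inverse (facet_det k pt i y)))"
  proof (rule sum.cong[OF refl])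
    fix i assume i: "i \<in> {..<k}"
    let ?C = "{..<k} - {i}"
    \<comment> \<open>The points off the facet \<open>?C\<close> are \<open>i\<close> and all those
      from \<open>k\<close> on, a set that \<open>f\<close> permutes.\<close>
    have "bij_betw f ({i} \<union> {k..<m}) ({i} \<union> {k..<m})"
      using i f(2,4) by (intro bij_betw_combine[of f "{i}" "{i}"]) auto
    moreover have "{..<m} - ?C = {i} \<union> {k..<m}" using i k n by (auto simp: m_def)
    ultimately have 1: "(\<Prod>z\<in>{..<m} - ?C. facet_det k pt i (f z)) = (\<Prod>z\<in>{..<m} - ?C. facet_det k pt i z)"
      by (simp add: prod.reindex_bij_betw)
    have "{..<2 * k - 2} - ?C = insert i {k..<k + (k - 2)}" using i k by auto
    then have 2: "(\<Prod>y\<in>{..<2 * k - 2} - ?C. facet_det k pt i (f y))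
        = facet_det k pt i i * (\<Prod>y\<in>Y. facet_det k pt i y)"
      using i f(2) prod.reindex_bij_betw[OF f(3), of "facet_det k pt i"] by simp
    show "inverse ((\<Prod>z\<in>{..<m} - ?C. facet_det k pt i (f z)) *
           (\<Prod>y\<in>{..<2 * k - 2} - ?C. facet_det k pt i (f y)))
      = inverse ((\<Prod>z\<in>{..<m} - ?C. facet_det k pt i z) * facet_det k pt i i)
        * (\<Prod>y\<in>Y. inverse (facet_det k pt i y))"
      unfolding 1 2 by (simp add: prod_inversef[unfolded comp_def])
  qed
  finally show ?thesis .
qed

lemma det_nonzero_if_diagonalized:
  fixes Q :: "'a::field mat"
  assumes "Q \<in> carrier_mat k k"
    and "\<And>j. j < k \<Longrightarrow> x j \<in> carrier_vec k" "\<And>j. j < k \<Longrightarrow> \<delta> j \<noteq> 0"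
    and "\<And>i j. i < k \<Longrightarrow> j < k \<Longrightarrow> (Q *\<^sub>v x j) $ i = (if i = j then \<delta> j else 0)"
  shows "det Q \<noteq> 0"
proof -
  define X where "X = mat_of_cols k (map x [0..<k])"
  define D where "D = mat k k (\<lambda>(i, j). if i = j then \<delta> j else 0)"
  have X: "X \<in> carrier_mat k k" and D: "D \<in> carrier_mat k k"
    by (auto simp: X_def D_def carrier_matI)
  have "Q * X = D"
  proof (rule eq_matI)
    fix i j assume "i < dim_row D" "j < dim_col D"
    then have ij: "i < k" "j < k" by (auto simp: D_def)
    have "col X j = x j" using ij assms(2) by (simp add: X_def)
    then have "(Q * X) $$ (i, j) = (Q *\<^sub>v x j) $ i"
      using ij assms(1) X by simp
    then show "(Q * X) $$ (i, j) = D $$ (i, j)" using assms(4)[OF ij] ij by (simp add: D_def)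
  qed (use assms(1) X D in auto)
  moreover have "upper_triangular D" by (auto simp: D_def)
  then have "det D = prod_list (diag_mat D)" using D by (rule det_upper_triangular)
  moreover have "prod_list (diag_mat D) \<noteq> 0"
    using assms(3) by (auto simp: prod_list_zero_iff diag_mat_def D_def)
  ultimately show ?thesis using det_mult[OF assms(1) X] by auto
qed

section \<open>The Cremona transform with respect to the first k points\<close>

context
  fixes k m :: nat and pt :: "nat \<Rightarrow> 'a::field vec" and d :: "nat \<Rightarrow> nat \<Rightarrow> 'a"
  defines "d \<equiv> facet_det k pt"
  assumes k: "2 \<le> k" and km: "2 * k < m" and gp: "general_position k {..<m} pt"
begin

lemma pt_carrier: "u < m \<Longrightarrow> pt u \<in> carrier_vec k"
  using gp by (auto simp: general_position_def)

lemma facet_functional: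
  assumes "i < k"
  obtains c where "c \<in> carrier_vec k" "\<And>u. u < m \<Longrightarrow> d i u = c \<bullet> pt u"
proof -
  let ?xs = "map pt (sorted_list_of_set ({..<k} - {i}))"
  have "Suc (length ?xs) = k" using assms by simp
  then obtain c where c: "c \<in> carrier_vec k"
    "\<And>x. x \<in> carrier_vec k \<Longrightarrow> row_det k (x # ?xs) = c \<bullet> x"
    by (rule row_det_functional) (rule that)
  have "d i u = c \<bullet> pt u" if "u < m" for u
    using c(2)[OF pt_carrier[OF that]] by (simp add: d_def facet_det_def sub_det_def)
  then show thesis using that c(1) by blast
qed

lemma facet_det_vanish:
  assumes "i < k" "u < k" "u \<noteq> i"
  shows "d i u = 0"
proof -
  have "u \<in> set (sorted_list_of_set ({..<k} - {i}))" using assms by simp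
  then show ?thesis unfolding d_def facet_det_def sub_det_def
    using assms pt_carrier km by (intro row_det_repeat) auto
qed

lemma facet_det_nonzero:
  assumes "i < k" "u = i \<or> k \<le> u" "u < m"
  shows "d i u \<noteq> 0"
  unfolding d_def facet_det_def using assms k km
  by (intro sub_det_nonzero[OF gp]) auto

lemma orthogonal_to_arc_imp_zero:
  assumes "v \<in> carrier_vec k" "finite P" "P \<subseteq> {..<m}" "card P = k" "\<And>p. p \<in> P \<Longrightarrow> v \<bullet> pt p = 0"
  shows "v = 0\<^sub>v k"
proof (rule orthogonal_to_basis_imp_zero)
  let ?p = "sorted_list_of_set P"
  have "distinct ?p" "set ?p \<subseteq> {..<m}" "length ?p = k" using assms by auto
  then show "row_det k (map pt ?p) \<noteq> 0" using gp unfolding general_position_def by blast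
qed (use assms pt_carrier in auto)

text \<open>Otherwise some combination of the coordinate forms \<open>i\<close> and \<open>j\<close>
  would vanish at \<open>b\<close>, \<open>c\<close> and the \<open>k - 2\<close> basis points other
  than \<open>i\<close> and \<open>j\<close>. These are \<open>k\<close> points in general position,
  so the form would be zero, but its value at the point \<open>i\<close> is not.\<close>

lemma facet_det_cross:
  assumes ij: "i < k" "j < k" "i \<noteq> j" and bc: "k \<le> b" "b < m" "k \<le> c" "c < m" "b \<noteq> c"
  shows "d i b * d j c \<noteq> d i c * d j b"
proof
  assume eq: "d i b * d j c = d i c * d j b"
  obtain fi where fi: "fi \<in> carrier_vec k" "\<And>u. u < m \<Longrightarrow> d i u = fi \<bullet> pt u"
    using facet_functional[OF ij(1)] by metis
  obtain fj where fj: "fj \<in> carrier_vec k" "\<And>u. u < m \<Longrightarrow> d j u = fj \<bullet> pt u"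
    using facet_functional[OF ij(2)] by metis
  define v where "v = d j b \<cdot>\<^sub>v fi - d i b \<cdot>\<^sub>v fj"
  have v: "v \<bullet> pt u = d j b * d i u - d i b * d j u" if "u < m" for u
    using fi fj pt_carrier[OF that] that unfolding v_def
    by (simp add: minus_scalar_prod_distrib[of _ k])
  let ?P = "{b, c} \<union> ({..<k} - {i, j})"
  have "v = 0\<^sub>v k"
  proof (rule orthogonal_to_arc_imp_zero[of _ ?P])
    have "{b, c} \<inter> ({..<k} - {i, j}) = {}" using bc by auto
    then show "card ?P = k" using ij bc k by (subst card_Un_disjoint) (auto simp: card_Diff_subset)
    show "v \<bullet> pt p = 0" if p: "p \<in> ?P" for p
    proof -
      have vp: "v \<bullet> pt p = d j b * d i p - d i b * d j p" using v[of p] p bc km by auto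
      consider "p = b" | "p = c" | "p < k" "p \<noteq> i" "p \<noteq> j" using p by auto
      then show ?thesis
      proof cases
        case 1
        then show ?thesis using vp by simp
      next
        case 2
        then show ?thesis using vp eq by (simp add: mult.commute)
      next
        case 3
        then show ?thesis
          using vp facet_det_vanish[OF ij(1), of p] facet_det_vanish[OF ij(2), of p] by simp
      qed
    qed
    show "?P \<subseteq> {..<m}" using bc km by auto
  qed (use fi fj in \<open>auto simp: v_def\<close>)
  moreover have "i < m" using ij km by simp
  ultimately have "d j b * d i i = 0"
    using v[of i] pt_carrier[of i] facet_det_vanish[of j i] ij by simp
  then show False
    using facet_det_nonzero[of j b] facet_det_nonzero[of i i] ij bc \<open>i < m\<close> by simp
qed

context
  fixes e :: "nat \<Rightarrow> 'a"
  assumes e: "\<And>i. i < k \<Longrightarrow> e i \<noteq> 0"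
    and power_identity: "\<And>Y. Y \<subseteq> {k..<m} \<Longrightarrow> card Y = k - 2 \<Longrightarrow>
      (\<Sum>i<k. e i * (\<Prod>y\<in>Y. inverse (d i y))) = 0"
begin

text \<open>
  The Cremona transform maps \<open>{k..<m}\<close> to a line. Choose a combination \<open>u\<close> of three transformed
  points whose first two coordinates vanish. For a set \<open>P\<close> of \<open>k - 2\<close> further points the identity
  makes \<open>e i * (\<Prod>p\<in>P. inverse (d i p)) * u i\<close> orthogonal to \<open>P \<union> {0, 1}\<close>, which is a basis.
\<close>

lemma cremona_collinear:
  assumes "{y, b, c} \<subseteq> {k..<m}" "distinct [y, b, c]"
  obtains \<beta> \<gamma> where "\<And>i. i < k \<Longrightarrow> inverse (d i y) = \<beta> * inverse (d i b) + \<gamma> * inverse (d i c)"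
proof -
  define w where "w i u = inverse (d i u)" for i u
  have wnz: "w i u \<noteq> 0" if "i < k" "u \<in> {k..<m}" for i u
    using that facet_det_nonzero[of i u] by (auto simp: w_def)
  define \<Delta> where "\<Delta> = w 0 b * w 1 c - w 0 c * w 1 b"
  have \<Delta>: "\<Delta> \<noteq> 0"
  proof -
    have "d 0 b * d 1 c \<noteq> d 0 c * d 1 b" using assms k by (intro facet_det_cross) auto
    moreover have "d 0 b \<noteq> 0" "d 1 b \<noteq> 0" "d 0 c \<noteq> 0" "d 1 c \<noteq> 0"
      using assms(1) k facet_det_nonzero[of 0] facet_det_nonzero[of 1] by simp_all
    ultimately show ?thesis by (simp add: \<Delta>_def w_def field_simps)
  qed
  \<comment> \<open>Cramer's rule for the coordinates 0 and 1, whose determinant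
    \<open>\<Delta>\<close> is nonzero by \<open>facet_det_cross\<close>.\<close>
  define \<beta> where "\<beta> = (w 0 y * w 1 c - w 0 c * w 1 y) / \<Delta>"
  define \<gamma> where "\<gamma> = (w 0 b * w 1 y - w 0 y * w 1 b) / \<Delta>"
  define u where "u i = w i y - \<beta> * w i b - \<gamma> * w i c" for i
  have u0: "u 0 = 0"
  proof -
    have "\<Delta> * u 0 = \<Delta> * w 0 y - (\<Delta> * \<beta>) * w 0 b - (\<Delta> * \<gamma>) * w 0 c"
      by (simp add: u_def algebra_simps)
    also have "\<dots> = 0" using \<Delta> by (simp add: \<beta>_def \<gamma>_def) (simp add: \<Delta>_def algebra_simps)
    finally show ?thesis using \<Delta> by simp
  qed
  have u1: "u 1 = 0"
  proof -
    have "\<Delta> * u 1 = \<Delta> * w 1 y - (\<Delta> * \<beta>) * w 1 b - (\<Delta> * \<gamma>) * w 1 c"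
      by (simp add: u_def algebra_simps)
    also have "\<dots> = 0" using \<Delta> by (simp add: \<beta>_def \<gamma>_def) (simp add: \<Delta>_def algebra_simps)
    finally show ?thesis using \<Delta> by simp
  qed
  \<comment> \<open>There are \<open>m - k \<ge> k + 1\<close> points outside the basis, so at least
    \<open>k - 2\<close> remain besides \<open>y\<close>, \<open>b\<close>,
    \<open>c\<close>.\<close>
  have "k - 2 \<le> card ({k..<m} - {y, b, c})"
    using assms km by (simp add: card_Diff_subset)
  then obtain P where P: "P \<subseteq> {k..<m} - {y, b, c}" "card P = k - 2" "finite P"
    by (meson obtain_subset_with_card_n)
  define v where "v i = e i * (\<Prod>p\<in>P. w i p) * u i" for i
  have "\<forall>i\<in>{..<k}. \<exists>c\<in>carrier_vec k. \<forall>u<m. d i u = c \<bullet> pt u"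
    using facet_functional by (metis lessThan_iff)
  then obtain f where f: "\<And>i. i < k \<Longrightarrow> f i \<in> carrier_vec k"
    "\<And>i u. i < k \<Longrightarrow> u < m \<Longrightarrow> d i u = f i \<bullet> pt u"
    by (metis lessThan_iff)
  define V where "V = vec k (\<lambda>l. \<Sum>i<k. v i * f i $ l)"
  have V: "V \<bullet> pt z = (\<Sum>i<k. v i * d i z)" if "z < m" for z
  proof -
    have "V \<bullet> pt z = (\<Sum>l<k. (\<Sum>i<k. v i * f i $ l) * pt z $ l)"
      using pt_carrier[OF that] by (simp add: V_def scalar_prod_def atLeast0LessThan)
    also have "\<dots> = (\<Sum>i<k. v i * (\<Sum>l<k. f i $ l * pt z $ l))"
      unfolding sum_distrib_left sum_distrib_right by (subst sum.swap) (simp add: mult.assoc)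
    also have "\<dots> = (\<Sum>i<k. v i * d i z)"
      using f that pt_carrier[OF that]
      by (intro sum.cong) (auto simp: scalar_prod_def atLeast0LessThan)
    finally show ?thesis .
  qed
  have V_basis: "V \<bullet> pt i = v i * d i i" if "i < k" for i
  proof -
    have "(\<Sum>j<k. v j * d j i) = (\<Sum>j<k. if j = i then v i * d i i else 0)"
      using that by (intro sum.cong) (auto simp: facet_det_vanish)
    then show ?thesis using V[of i] that km by simp
  qed
  have "V = 0\<^sub>v k"
  proof (rule orthogonal_to_arc_imp_zero[of _ "{0, 1} \<union> P"])
    have "{0, 1} \<inter> P = {}" using P(1) k by auto
    then show "card ({0, 1} \<union> P) = k" using P k by (subst card_Un_disjoint) auto
    show "V \<bullet> pt p = 0" if p: "p \<in> {0, 1} \<union> P" for p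
    proof (cases "p \<in> P")
      case False
      then have "p = 0 \<or> p = 1" using p by auto
      then show ?thesis using V_basis[of p] u0 u1 k by (auto simp: v_def)
    next
      case True
      have pm: "p \<in> {k..<m}" using True P by auto
      \<comment> \<open>Exchanging \<open>p\<close> in \<open>P\<close> for \<open>y\<close>,
        \<open>b\<close> or \<open>c\<close> gives sets to which the identity applies. Multiplying
        \<open>v i\<close> by \<open>d i p\<close> removes the factor of \<open>p\<close>, so the
        value of \<open>V\<close> at \<open>p\<close> is a combination of these three sums.\<close>
      let ?W = "\<lambda>z. \<Sum>i<k. e i * (\<Prod>q\<in>insert z (P - {p}). w i q)"
      have W: "?W z = 0" if z: "z \<in> {y, b, c}" for z
      proof -
        have "z \<notin> P" "z \<in> {k..<m}" using z P assms by auto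
        then have "insert z (P - {p}) \<subseteq> {k..<m}" "card (insert z (P - {p})) = k - 2"
          using P True by (auto simp: card_Suc_Diff1)
        then show ?thesis unfolding w_def by (rule power_identity)
      qed
      have Wz: "?W z = (\<Sum>i<k. e i * (\<Prod>q\<in>P - {p}. w i q) * w i z)" if "z \<in> {y, b, c}" for z
      proof -
        have "z \<notin> P - {p}" using that P by auto
        then show ?thesis using P(3) by (simp add: mult_ac)
      qed
      have "V \<bullet> pt p = (\<Sum>i<k. v i * d i p)" using V pm by simp
      also have "\<dots> = (\<Sum>i<k. e i * (\<Prod>q\<in>P - {p}. w i q) * u i)"
      proof (rule sum.cong[OF refl])
        fix i assume i: "i \<in> {..<k}"
        have "(\<Prod>q\<in>P. w i q) * d i p = (\<Prod>q\<in>P - {p}. w i q)"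
          using prod.remove[OF P(3) True, of "w i"] facet_det_nonzero[of i p] i pm
          by (simp add: w_def)
        then show "v i * d i p = e i * (\<Prod>q\<in>P - {p}. w i q) * u i"
          by (simp add: v_def mult_ac)
      qed
      also have "\<dots> = ?W y - \<beta> * ?W b - \<gamma> * ?W c"
        using Wz by (simp add: u_def algebra_simps sum_distrib_left sum.distrib sum_subtractf)
      also have "\<dots> = 0" using W by simp
      finally show ?thesis .
    qed
    show "{0, 1} \<union> P \<subseteq> {..<m}" using P k km by auto
  qed (use P in \<open>auto simp: V_def\<close>)
  have "u i = 0" if i: "i < k" for i
  proof -
    have "V \<bullet> pt i = 0" using \<open>V = 0\<^sub>v k\<close> pt_carrier[of i] i km by simp
    then have "v i = 0" using V_basis[OF i] facet_det_nonzero[of i i] i km by simp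
    moreover have "(\<Prod>p\<in>P. w i p) \<noteq> 0" using wnz[OF i] P by auto
    ultimately show ?thesis using e[OF i] by (simp add: v_def)
  qed
  then show thesis by (intro that[of \<beta> \<gamma>]) (simp add: u_def w_def algebra_simps)
qed

end

end

subsection \<open>Parametrization by the normal rational curve\<close>

text \<open>\<open>'a option\<close> serves as the projective line, with \<open>None\<close> as the
  point at infinity.\<close>

definition nrc_point :: "nat \<Rightarrow> 'a::field option \<Rightarrow> 'a vec" where
  "nrc_point k x = (case x of None \<Rightarrow> unit_vec k (k - 1) | Some t \<Rightarrow> vec k (\<lambda>i. t ^ i))"

lemma nrc_point_carrier [simp]: "nrc_point k x \<in> carrier_vec k"
  by (simp add: nrc_point_def split: option.split)

lemma bij_betw_nrc_point:
  assumes "2 \<le> k"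
  shows "bij_betw (nrc_point k) UNIV (normal_rational_curve k :: 'a::field vec set)"
  unfolding bij_betw_def
proof
  show "inj (nrc_point k :: 'a option \<Rightarrow> 'a vec)"
  proof (rule injI)
    fix x y :: "'a option" assume eq: "nrc_point k x = nrc_point k y"
    have "nrc_point k x $ 0 = nrc_point k y $ 0" "nrc_point k x $ 1 = nrc_point k y $ 1"
      by (simp_all add: eq)
    then show "x = y" using assms
      by (auto simp: nrc_point_def unit_vec_def split: option.splits)
  qed
  show "range (nrc_point k) = (normal_rational_curve k :: 'a vec set)"
  proof (intro equalityI subsetI)
    fix x :: "'a vec" assume "x \<in> normal_rational_curve k"
    then show "x \<in> range (nrc_point k)"
      unfolding normal_rational_curve_def
      by (auto simp: nrc_point_def intro: range_eqI[of _ _ None] range_eqI[of _ _ "Some _"])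
  qed (auto simp: nrc_point_def normal_rational_curve_def split: option.splits)
qed

text \<open>A kernel vector holds the coefficients of a polynomial of degree at most
  \<open>k - 1\<close> that vanishes at the chosen parameters. If infinity is among them, the top
  coefficient vanishes as well; either way there are more roots than the degree allows.\<close>

lemma general_position_nrc_point:
  assumes "2 \<le> k"
  shows "general_position k UNIV (nrc_point k :: 'a::field option \<Rightarrow> 'a vec)"
  unfolding general_position_def
proof (intro conjI allI impI)
  fix p :: "'a option list" assume p: "distinct p" "length p = k"
  let ?A = "mat_of_rows k (map (nrc_point k) p)"
  have A: "?A \<in> carrier_mat k k" using p by (simp add: carrier_matI)
  show "row_det k (map (nrc_point k) p) \<noteq> 0"
  proof
    assume "row_det k (map (nrc_point k) p) = 0"
    then obtain v where v: "v \<in> carrier_vec k" "v \<noteq> 0\<^sub>v k" "?A *\<^sub>v v = 0\<^sub>v k"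
      using det_0_iff_vec_prod_zero_field[OF A] by (auto simp: row_det_def)
    have orth: "nrc_point k x \<bullet> v = 0" if x: "x \<in> set p" for x
    proof -
      obtain i where i: "i < k" "x = p ! i" using x p by (auto simp: in_set_conv_nth)
      have "(?A *\<^sub>v v) $ i = nrc_point k x \<bullet> v" using i p by (simp add: mat_of_rows_row)
      then show ?thesis using v(3) i by simp
    qed
    define f where "f = (\<Sum>l<k. monom (v $ l) l)"
    have coeff: "coeff f l = (if l < k then v $ l else 0)" for l
      by (simp add: f_def coeff_sum)
    have poly: "poly f t = nrc_point k (Some t) \<bullet> v" for t
      using v(1) by (simp add: f_def poly_sum poly_monom nrc_point_def scalar_prod_def
          atLeast0LessThan mult.commute)
    have f: "f \<noteq> 0"
    proof
      assume "f = 0"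
      then have "v $ l = 0" if "l < k" for l using coeff[of l] that by simp
      then show False using v(1,2) by (auto simp: vec_eq_iff)
    qed
    define Z where "Z = {t. Some t \<in> set p}"
    have finZ: "finite Z" unfolding Z_def by (rule finite_vimageI[of "set p" Some, unfolded vimage_def]) auto
    have "card Z \<le> card {t. poly f t = 0}"
      using orth poly by (intro card_mono poly_roots_finite f) (auto simp: Z_def)
    also have "\<dots> \<le> degree f" by (rule card_poly_roots_bound[OF f])
    finally have le: "card Z \<le> degree f" .
    have card_p: "card (set p) = k" using p by (simp add: distinct_card)
    have card_some: "card (Some ` Z) = card Z" by (simp add: card_image)
    have deg: "degree f \<le> k - 1" by (rule degree_le) (auto simp: coeff)
    show False
    proof (cases "None \<in> set p")
      case True
      have "set p = insert None (Some ` Z)"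
        using True by (auto simp: Z_def image_iff) (metis option.exhaust)
      then have "card Z = k - 1" using card_p card_some finZ by simp
      then have "degree f = k - 1" using le deg by simp
      moreover have "v $ (k - 1) = 0"
        using orth[OF True] v(1) assms by (simp add: nrc_point_def)
      ultimately have "lead_coeff f = 0" using coeff[of "k - 1"] assms by simp
      then show False using f by simp
    next
      case False
      then have "set p = Some ` Z"
        by (auto simp: Z_def image_iff) (metis option.exhaust)
      then have "card Z = k" using card_p card_some by simp
      then show False using le deg assms by simp
    qed
  qed
qed auto

text \<open>The Lagrange numerators for the nodes \<open>r 0, ..., r (k - 1)\<close> as forms of
  degree \<open>k - 1\<close> on the projective line; the value at infinity is the leading
  coefficient.\<close>

definition nodal :: "nat \<Rightarrow> (nat \<Rightarrow> 'a::field) \<Rightarrow> nat \<Rightarrow> 'a option \<Rightarrow> 'a" where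
  "nodal k r i x = (case x of None \<Rightarrow> 1 | Some t \<Rightarrow> \<Prod>j\<in>{..<k} - {i}. t - r j)"

text \<open>
  In the coordinates \<open>facet_det k pt i\<close> the points \<open>0, \<dots>, k - 1\<close> are the unit vectors; the point
  \<open>k\<close> goes to the parameter at infinity, and the coordinates of a further point are the inverses of
  the values \<open>r i - t\<close> of the parametrized line found in \<open>cremona_collinear\<close>.
\<close>

lemma arc_parametrization:
  fixes pt :: "nat \<Rightarrow> 'a::{field,finite} vec" and k m :: nat and d :: "nat \<Rightarrow> nat \<Rightarrow> 'a"
  defines "d \<equiv> facet_det k pt"
  assumes k: "2 \<le> k" and km: "2 * k < m" and m: "m = CARD('a) + 1"
    and gp: "general_position k {..<m} pt"
    and e: "\<And>i. i < k \<Longrightarrow> e i \<noteq> 0"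
    and power_identity: "\<And>Y. Y \<subseteq> {k..<m} \<Longrightarrow> card Y = k - 2 \<Longrightarrow>
      (\<Sum>i<k. e i * (\<Prod>y\<in>Y. inverse (d i y))) = 0"
  obtains r c s \<tau> where "inj_on r {..<k}" "\<And>i. i < k \<Longrightarrow> c i \<noteq> 0" "\<And>u. u < m \<Longrightarrow> s u \<noteq> 0"
    "bij_betw \<tau> {..<m} UNIV"
    "\<And>u i. u < m \<Longrightarrow> i < k \<Longrightarrow> s u * d i u = c i * nodal k r i (\<tau> u)"
proof -
  note cross = facet_det_cross[OF k km gp, folded d_def]
  note vanish = facet_det_vanish[OF k km gp, folded d_def]
  note nonzero = facet_det_nonzero[OF k km gp, folded d_def]
  \<comment> \<open>The point \<open>b\<close> gets the parameter at infinity, \<open>c\<close> the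
    parameter 0, and the basis point \<open>i\<close> the parameter \<open>r i\<close>.\<close>
  define b where "b = k"
  define c where "c = Suc k"
  define r where "r i = d i b / d i c" for i
  have b: "k \<le> b" "b < m" and c: "k \<le> c" "c < m" and bc: "b \<noteq> c" using k km by (auto simp: b_def c_def)
  have bnz: "d i b \<noteq> 0" and cnz: "d i c \<noteq> 0" if "i < k" for i
    using nonzero[OF that] b c by auto
  have r: "inj_on r {..<k}"
  proof (rule inj_onI)
    fix i j assume ij: "i \<in> {..<k}" "j \<in> {..<k}" "r i = r j"
    then have "d i b * d j c = d i c * d j b"
      using cnz by (simp add: r_def field_simps)
    then show "i = j" using cross[of i j b c] ij b c bc by blast
  qed
  \<comment> \<open>Multiplying the relation of \<open>cremona_collinear\<close> by
    \<open>d i b\<close> gives \<open>\<beta> + \<gamma> * r i\<close>, an affine function of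
    \<open>r i\<close> with zero \<open>t\<close>.\<close>
  have "\<exists>\<gamma> t. \<gamma> \<noteq> 0 \<and> (\<forall>i<k. d i b * inverse (d i y) = \<gamma> * (r i - t))"
    if y: "y \<in> {k..<m} - {b}" for y
  proof (cases "y = c")
    case True
    then show ?thesis by (intro exI[of _ 1] exI[of _ 0]) (simp add: r_def divide_inverse)
  next
    case False
    have ybc: "{y, b, c} \<subseteq> {k..<m}" "distinct [y, b, c]" using False y b c bc by auto
    obtain \<beta> \<gamma> where \<beta>\<gamma>: "\<And>i. i < k \<Longrightarrow> inverse (d i y) = \<beta> * inverse (d i b) + \<gamma> * inverse (d i c)"
      by (rule cremona_collinear[OF k km gp _ _ ybc, folded d_def], erule e,
          erule (1) power_identity, rule that)
    have "\<gamma> \<noteq> 0"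
    proof
      assume "\<gamma> = 0"
      then have "d i b = \<beta> * d i y" if "i < k" for i
        using \<beta>\<gamma>[OF that] bnz[OF that] nonzero[OF that, of y] y by (simp add: field_simps)
      then have "d 0 b * d 1 y = d 0 y * d 1 b" using k by simp
      then show False using cross[of 0 1 b y] k b y by auto
    qed
    moreover have "d i b * inverse (d i y) = \<gamma> * (r i - (- \<beta> / \<gamma>))" if "i < k" for i
    proof -
      have "\<gamma> * (r i - (- \<beta> / \<gamma>)) = \<gamma> * r i + \<beta>" using \<open>\<gamma> \<noteq> 0\<close> by (simp add: field_simps)
      then show ?thesis
        using bnz[OF that] by (simp add: \<beta>\<gamma>[OF that] r_def distrib_left divide_inverse)
    qed
    ultimately show ?thesis by blast
  qed
  then obtain \<gamma> t where \<gamma>: "\<And>y. y \<in> {k..<m} - {b} \<Longrightarrow> \<gamma> y \<noteq> 0"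
    and param: "\<And>y i. y \<in> {k..<m} - {b} \<Longrightarrow> i < k \<Longrightarrow> d i b * inverse (d i y) = \<gamma> y * (r i - t y)"
    by metis
  have tr: "t y \<noteq> r i" if "y \<in> {k..<m} - {b}" "i < k" for y i
    using param[OF that] bnz[OF that(2)] nonzero[OF that(2), of y] that by auto
  \<comment> \<open>Equal parameters would make the coordinates of \<open>y\<close> and
    \<open>z\<close> proportional, against \<open>facet_det_cross\<close>.\<close>
  have t_inj: "y = z" if yz: "y \<in> {k..<m} - {b}" "z \<in> {k..<m} - {b}" "t y = t z" for y z
  proof (rule ccontr)
    assume "y \<noteq> z"
    have "\<gamma> z * d i z = \<gamma> y * d i y" if i: "i < k" for i
    proof -
      have nz: "d i y \<noteq> 0" "d i z \<noteq> 0" using nonzero[OF i] yz by auto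
      have rt: "r i - t z \<noteq> 0" using tr[OF yz(2) i] by simp
      have "\<gamma> y * (r i - t z) * d i y = d i b" "\<gamma> z * (r i - t z) * d i z = d i b"
        using param[OF yz(1) i] param[OF yz(2) i] nz yz(3) by (simp_all add: field_simps)
      then have "(r i - t z) * (\<gamma> z * d i z) = (r i - t z) * (\<gamma> y * d i y)"
        by (simp add: mult_ac)
      then show ?thesis using rt by simp
    qed
    then have "d i y = \<gamma> z / \<gamma> y * d i z" if "i < k" for i
      using \<gamma>[OF yz(1)] that by (simp add: field_simps)
    then have "d 0 y * d 1 z = d 0 z * d 1 y" using k by simp
    then show False using cross[of 0 1 y z] k yz \<open>y \<noteq> z\<close> by auto
  qed
  define \<tau> where "\<tau> u = (if u < k then Some (r u) else if u = b then None else Some (t u))" for u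
  have inj: "inj_on \<tau> {..<m}"
  proof (rule inj_onI)
    fix u u' assume u: "u \<in> {..<m}" "u' \<in> {..<m}" "\<tau> u = \<tau> u'"
    then show "u = u'"
      using inj_onD[OF r, of u u'] t_inj[of u u'] tr[of u u'] tr[of u' u] b(1)
      by (auto simp: \<tau>_def split: if_splits)
  qed
  \<comment> \<open>Here the full size of the arc enters: \<open>m = CARD('a) + 1\<close> is the
    size of \<open>'a option\<close>, so the injective \<open>\<tau>\<close> takes every
    value.\<close>
  have "\<tau> ` {..<m} = UNIV" using card_image[OF inj] m by (intro card_subset_eq) auto
  with inj have \<tau>: "bij_betw \<tau> {..<m} UNIV" by (simp add: bij_betw_def)
  \<comment> \<open>A basis point has a single nonzero coordinate, and \<open>s\<close> is fitted to
    it. At \<open>b\<close> both sides are \<open>d i b\<close>. Elsewhere the product over all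
    \<open>j < k\<close> supplies the factor \<open>t u - r i\<close> missing from
    \<open>nodal\<close>, and the minus sign turns it into \<open>r i - t u\<close>.\<close>
  define s where "s u = (if u < k then d u b * nodal k r u (Some (r u)) / d u u
    else if u = b then 1 else - \<gamma> u * (\<Prod>j<k. t u - r j))" for u
  have nodal_self: "nodal k r u (Some (r u)) \<noteq> 0" if "u < k" for u
    using that inj_onD[OF r, of u] by (auto simp: nodal_def)
  show thesis
  proof (rule that[OF r _ _ \<tau>])
    show "d i b \<noteq> 0" if "i < k" for i by (rule bnz[OF that])
    show "s u \<noteq> 0" if "u < m" for u
      using that nodal_self[of u] bnz[of u] nonzero[of u u] \<gamma>[of u] tr[of u]
      by (auto simp: s_def)
    show "s u * d i u = d i b * nodal k r i (\<tau> u)" if ui: "u < m" "i < k" for u i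
    proof -
      consider "u < k" "u = i" | "u < k" "u \<noteq> i" | "u = b" | "u \<in> {k..<m} - {b}"
        using ui by fastforce
      then show ?thesis
      proof cases
        case 1
        then show ?thesis using nonzero[of u u] ui by (simp add: s_def \<tau>_def)
      next
        case 2
        then have "nodal k r i (Some (r u)) = 0" by (auto simp: nodal_def)
        then show ?thesis using 2 vanish[OF ui(2), of u] by (simp add: \<tau>_def)
      next
        case 3
        then show ?thesis using b by (simp add: s_def \<tau>_def nodal_def)
      next
        case 4
        have "d i u \<noteq> 0" using nonzero[OF ui(2), of u] 4 by auto
        then have dib: "d i b = \<gamma> u * (r i - t u) * d i u"
          using param[OF 4 ui(2)] by (simp add: field_simps)
        have prod_eq: "(\<Prod>j<k. t u - r j) = (t u - r i) * nodal k r i (Some (t u))"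
          using ui(2) by (subst prod.remove[of _ i]) (auto simp: nodal_def)
        have "s u * d i u = (\<gamma> u * (r i - t u) * d i u) * nodal k r i (\<tau> u)"
          using 4 by (simp add: s_def \<tau>_def prod_eq algebra_simps)
        then show ?thesis by (simp only: dib)
      qed
    qed
  qed
qed

section \<open>Coordinate changes for the curve and for the arc\<close>

text \<open>The rows hold the coefficients of the scaled Lagrange numerators, so multiplying a curve
  point evaluates them, with \<open>None\<close> reading off the leading coefficient. At the
  parameters \<open>r j\<close> the values form a diagonal matrix, whence invertibility.\<close>

lemma lagrange_matrix:
  fixes r c :: "nat \<Rightarrow> 'a::field"
  assumes r: "inj_on r {..<k}" and c: "\<And>i. i < k \<Longrightarrow> c i \<noteq> 0" and k: "2 \<le> k"
  obtains Q where "Q \<in> carrier_mat k k" "det Q \<noteq> 0"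
    "\<And>x. Q *\<^sub>v nrc_point k x = vec k (\<lambda>i. c i * nodal k r i x)"
proof -
  define g where "g i = (\<Prod>j\<in>{..<k} - {i}. [:- r j, 1:])" for i
  define Q where "Q = mat k k (\<lambda>(i, l). c i * coeff (g i) l)"
  have Q: "Q \<in> carrier_mat k k" by (simp add: Q_def)
  have deg: "degree (g i) = k - 1" if "i < k" for i
    unfolding g_def using that by (subst degree_prod_eq_sum_degree) auto
  have lead: "coeff (g i) (k - 1) = 1" if "i < k" for i
  proof -
    have "lead_coeff (g i) = 1" unfolding g_def lead_coeff_prod by simp
    then show ?thesis using deg[OF that] by simp
  qed
  have Q_nrc: "Q *\<^sub>v nrc_point k x = vec k (\<lambda>i. c i * nodal k r i x)" for x
  proof (rule eq_vecI)
    fix i assume "i < dim_vec (vec k (\<lambda>i. c i * nodal k r i x))"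
    then have i: "i < k" by simp
    show "(Q *\<^sub>v nrc_point k x) $ i = vec k (\<lambda>i. c i * nodal k r i x) $ i"
    proof (cases x)
      case None
      then show ?thesis using i k lead[OF i] Q by (simp add: nrc_point_def nodal_def) (simp add: Q_def)
    next
      case (Some t)
      have "(Q *\<^sub>v nrc_point k x) $ i = (\<Sum>l<k. c i * coeff (g i) l * t ^ l)"
        using i Some by (simp add: Q_def nrc_point_def scalar_prod_def atLeast0LessThan)
      also have "\<dots> = c i * (\<Sum>l<k. coeff (g i) l * t ^ l)"
        by (simp add: sum_distrib_left mult.assoc)
      also have "{..<k} = {..degree (g i)}" using deg[OF i] k by auto
      also have "(\<Sum>l\<le>degree (g i). coeff (g i) l * t ^ l) = poly (g i) t"
        by (simp add: poly_altdef)
      also have "poly (g i) t = nodal k r i x"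
        by (simp add: g_def poly_prod Some nodal_def)
      finally show ?thesis using i by simp
    qed
  qed (simp add: Q_def)
  have "det Q \<noteq> 0"
  proof (rule det_nonzero_if_diagonalized[OF Q])
    fix i j assume ij: "i < k" "j < k"
    show "(Q *\<^sub>v nrc_point k (Some (r j))) $ i
        = (if i = j then c j * nodal k r j (Some (r j)) else 0)"
      using ij by (auto simp: Q_nrc nodal_def)
  next
    fix j assume "j < k"
    then show "c j * nodal k r j (Some (r j)) \<noteq> 0"
      using c[of j] inj_onD[OF r, of j] by (auto simp: nodal_def)
  qed simp
  then show thesis using that Q Q_nrc by blast
qed

lemma facet_matrix:
  fixes pt :: "nat \<Rightarrow> 'a::field vec"
  assumes k: "2 \<le> k" and km: "2 * k < m" and gp: "general_position k {..<m} pt"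
  obtains T where "T \<in> carrier_mat k k" "det T \<noteq> 0"
    "\<And>u. u < m \<Longrightarrow> T *\<^sub>v pt u = vec k (\<lambda>i. facet_det k pt i u)"
proof -
  have "\<forall>i\<in>{..<k}. \<exists>f\<in>carrier_vec k. \<forall>u<m. facet_det k pt i u = f \<bullet> pt u"
    using facet_functional[OF k km gp] by (metis lessThan_iff)
  then obtain f where f: "\<And>i. i < k \<Longrightarrow> f i \<in> carrier_vec k"
    "\<And>i u. i < k \<Longrightarrow> u < m \<Longrightarrow> facet_det k pt i u = f i \<bullet> pt u"
    by (metis lessThan_iff)
  define T where "T = mat_of_rows k (map f [0..<k])"
  have T: "T \<in> carrier_mat k k" by (simp add: T_def carrier_matI)
  have T_pt: "T *\<^sub>v pt u = vec k (\<lambda>i. facet_det k pt i u)" if "u < m" for u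
    using f that by (intro eq_vecI) (auto simp: T_def mat_of_rows_row)
  have "det T \<noteq> 0"
  proof (rule det_nonzero_if_diagonalized[OF T])
    fix i j assume ij: "i < k" "j < k"
    then show "(T *\<^sub>v pt j) $ i = (if i = j then facet_det k pt j j else 0)"
      using T_pt[of j] facet_det_vanish[OF k km gp, of i j] km by auto
  next
    fix j assume "j < k"
    then show "pt j \<in> carrier_vec k" "facet_det k pt j j \<noteq> 0"
      using pt_carrier[OF k km gp, of j] facet_det_nonzero[OF k km gp, of j j] km by auto
  qed
  then show thesis using that T T_pt by blast
qed

lemma nrc_enumeration:
  fixes R :: "'a::{field,finite} vec list"
  assumes k: "2 \<le> k" and R: "distinct R" "set R = normal_rational_curve k"
  obtains \<omega> where "bij_betw \<omega> {..<length R} (UNIV :: 'a option set)"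
    "\<And>j. j < length R \<Longrightarrow> R ! j = nrc_point k (\<omega> j)"
proof -
  define \<omega> where "\<omega> j = inv_into UNIV (nrc_point k) (R ! j)" for j
  note bij = bij_betw_nrc_point[OF k, where 'a = 'a]
  have R_bij: "bij_betw ((!) R) {..<length R} (normal_rational_curve k)"
    by (rule bij_betw_nth) (use R in auto)
  have "bij_betw (inv_into UNIV (nrc_point k) \<circ> (!) R) {..<length R} (UNIV :: 'a option set)"
    by (rule bij_betw_trans[OF R_bij bij_betw_inv_into[OF bij]])
  then have "bij_betw \<omega> {..<length R} UNIV" by (simp add: \<omega>_def[abs_def] comp_def)
  moreover have "R ! j = nrc_point k (\<omega> j)" if "j < length R" for j
  proof -
    have "R ! j \<in> range (nrc_point k)"
      using that R(2) nth_mem[of j R] bij by (auto simp: bij_betw_def)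
    then show ?thesis unfolding \<omega>_def by (simp add: f_inv_into_f)
  qed
  ultimately show thesis using that by blast
qed

lemma nrc_is_arc:
  fixes R :: "'a::{field,finite} vec list"
  assumes k: "2 \<le> k" "k \<le> CARD('a) + 1" and R: "distinct R" "set R = normal_rational_curve k"
  shows "is_arc k R" "length R = CARD('a) + 1"
proof -
  obtain \<omega> where \<omega>: "bij_betw \<omega> {..<length R} (UNIV :: 'a option set)"
    "\<And>j. j < length R \<Longrightarrow> R ! j = nrc_point k (\<omega> j)"
    by (rule nrc_enumeration[OF k(1) R]) (rule that)
  show len: "length R = CARD('a) + 1" using bij_betw_same_card[OF \<omega>(1)] by simp
  have "general_position k {..<length R} (\<lambda>j. nrc_point k (\<omega> j))"
    using general_position_reindex[OF general_position_nrc_point[OF k(1)]] \<omega>(1)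
    by (auto simp: bij_betw_def)
  then have "general_position k {..<length R} ((!) R)"
    by (rule general_position_cong) (simp add: \<omega>(2))
  then show "is_arc k R" using is_arc_iff_general_position[of k R] k len by simp
qed

theorem theorem1p12:
  fixes k n :: nat and B :: "'a::{field,finite} vec list"
  assumes "2 \<le> k"
    and "n + 2 * k \<le> CARD('a)"
    and "ordered_basis k B"
    and "\<And>G :: 'a vec list. is_arc k G \<Longrightarrow> length G = 2 * k - 2 + n \<Longrightarrow>
      vec ((2 * k - 2 + n) choose (k - 1)) (\<lambda>i. if i < k then 1 else 0)
        \<in> column_space (H_mat k B n G)"
  shows "\<forall>R :: 'a vec list. distinct R \<and> set R = normal_rational_curve k \<longrightarrow>
    is_arc k R \<and> length R = CARD('a) + 1 \<and>
    (\<forall>G :: 'a vec list. is_arc k G \<and> length G = CARD('a) + 1 \<longrightarrow> linearly_equivalent k B G R)"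
proof (intro allI impI)
  fix R :: "'a vec list"
  assume "distinct R \<and> set R = normal_rational_curve k"
  then have R: "distinct R" "set R = normal_rational_curve k" by auto
  define m where "m = CARD('a) + 1"
  have km: "2 * k < m" using assms(2) by (simp add: m_def)
  have arc_R: "is_arc k R" "length R = m"
    using nrc_is_arc[OF assms(1) _ R] km by (auto simp: m_def)
  have "linearly_equivalent k B G R" if G: "is_arc k G" "length G = m" for G
  proof -
    define pt where "pt i = coords k B (G ! i)" for i
    have gpG: "general_position k {..<m} ((!) G)"
      using G is_arc_iff_general_position[of k G] assms(1) by simp
    have gp: "general_position k {..<m} pt"
      unfolding pt_def by (rule general_position_coords[OF assms(3) gpG])
    define e where "e i = inverse ((\<Prod>z\<in>{..<m} - ({..<k} - {i}). facet_det k pt i z) * facet_det k pt i i)"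
      for i
    have e: "e i \<noteq> 0" if "i < k" for i
    proof -
      have "facet_det k pt i z \<noteq> 0" if "z \<in> {..<m} - ({..<k} - {i})" for z
        using that \<open>i < k\<close> by (intro facet_det_nonzero[OF assms(1) km gp]) auto
      moreover have "i \<in> {..<m} - ({..<k} - {i})" using that km by simp
      ultimately show ?thesis by (simp add: e_def)
    qed
    have power_identity: "(\<Sum>i<k. e i * (\<Prod>y\<in>Y. inverse (facet_det k pt i y))) = 0"
      if "Y \<subseteq> {k..<m}" "card Y = k - 2" for Y
      using arc_power_identity[OF assms, of G Y] G that by (simp add: e_def m_def pt_def[abs_def])
    obtain r c s \<tau> where r: "inj_on r {..<k}" and c: "\<And>i. i < k \<Longrightarrow> c i \<noteq> 0"
      and s: "\<And>u. u < m \<Longrightarrow> s u \<noteq> 0" and \<tau>: "bij_betw \<tau> {..<m} UNIV"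
      and param: "\<And>u i. u < m \<Longrightarrow> i < k \<Longrightarrow> s u * facet_det k pt i u = c i * nodal k r i (\<tau> u)"
      by (rule arc_parametrization[OF assms(1) km m_def gp], erule e, erule (1) power_identity, rule that)
    obtain T where T: "T \<in> carrier_mat k k" "det T \<noteq> 0"
      and T_pt: "\<And>u. u < m \<Longrightarrow> T *\<^sub>v pt u = vec k (\<lambda>i. facet_det k pt i u)"
      by (rule facet_matrix[OF assms(1) km gp]) (rule that)
    obtain Q where Q: "Q \<in> carrier_mat k k" "det Q \<noteq> 0"
      and Q_nrc: "\<And>x. Q *\<^sub>v nrc_point k x = vec k (\<lambda>i. c i * nodal k r i x)"
      by (rule lagrange_matrix[OF r c assms(1)]) (auto intro: that)
    obtain \<omega> where \<omega>: "bij_betw \<omega> {..<m} (UNIV :: 'a option set)"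
      "\<And>j. j < m \<Longrightarrow> R ! j = nrc_point k (\<omega> j)"
      using nrc_enumeration[OF assms(1) R] arc_R(2) by metis
    \<comment> \<open>Sends the position of a curve point in \<open>R\<close> to the position in
      \<open>G\<close> with the same parameter; \<open>permutes\<close> demands the identity outside
      \<open>{..<m}\<close>.\<close>
    define \<pi> where "\<pi> j = (if j < m then inv_into {..<m} \<tau> (\<omega> j) else j)" for j
    have "bij_betw (inv_into {..<m} \<tau> \<circ> \<omega>) {..<m} {..<m}"
      by (rule bij_betw_trans[OF \<omega>(1) bij_betw_inv_into[OF \<tau>]])
    then have "bij_betw \<pi> {..<m} {..<m}"
      by (subst bij_betw_cong[of _ \<pi> "inv_into {..<m} \<tau> \<circ> \<omega>"]) (auto simp: \<pi>_def)
    then have \<pi>: "\<pi> permutes {..<m}" by (rule bij_imp_permutes) (simp add: \<pi>_def)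
    have \<tau>\<pi>: "\<tau> (\<pi> j) = \<omega> j" if "j < m" for j
      using that bij_betw_inv_into_right[OF \<tau>] by (simp add: \<pi>_def)
    let ?B = "mat_of_cols k B"
    have B: "?B \<in> carrier_mat k k" "det ?B \<noteq> 0"
      using assms(3) row_det_eq_det_cols[of B k] by (auto simp: ordered_basis_iff_row_det)
    show ?thesis unfolding linearly_equivalent_def
    \<comment> \<open>The common system is that of the facet coordinates: \<open>T\<close> takes the
      coordinates of \<open>G\<close> there, while \<open>Q * ?B\<close> first recovers the curve
      point from its coordinates and then evaluates the scaled nodal forms at it.\<close>
    proof (rule equiv_steps_columnwise[OF T _ _ _ _ \<pi>, of "Q * ?B"])
      show "Q * ?B \<in> carrier_mat k k" "det (Q * ?B) \<noteq> 0"
        using Q B by (auto simp: det_mult)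
      show "s (\<pi> j) \<noteq> 0" if "j < m" for j
        using s permutes_in_image[OF \<pi>, of j] that by simp
      fix j assume j: "j < m"
      have \<pi>j: "\<pi> j < m" using permutes_in_image[OF \<pi>, of j] j by simp
      have Rj: "R ! j \<in> carrier_vec k" using \<omega>(2)[OF j] by simp
      have "col (mat_of_cols k (map (coords k B) R)) j = coords k B (R ! j)"
        using j arc_R(2) coords_props(1)[OF assms(3) Rj] by simp
      then have "(Q * ?B) *\<^sub>v col (mat_of_cols k (map (coords k B) R)) j = Q *\<^sub>v (R ! j)"
        using Q B coords_props[OF assms(3) Rj] by simp
      also have "\<dots> = vec k (\<lambda>i. c i * nodal k r i (\<tau> (\<pi> j)))"
        by (simp add: \<omega>(2)[OF j] Q_nrc \<tau>\<pi>[OF j])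
      also have "\<dots> = s (\<pi> j) \<cdot>\<^sub>v (T *\<^sub>v pt (\<pi> j))"
        using param[OF \<pi>j] by (intro eq_vecI) (auto simp: T_pt[OF \<pi>j])
      also have "pt (\<pi> j) = col (mat_of_cols k (map (coords k B) G)) (\<pi> j)"
        using \<pi>j G(2) pt_carrier[OF assms(1) km gp \<pi>j] by (simp add: pt_def)
      finally show "(Q * ?B) *\<^sub>v col (mat_of_cols k (map (coords k B) R)) j
          = s (\<pi> j) \<cdot>\<^sub>v (T *\<^sub>v col (mat_of_cols k (map (coords k B) G)) (\<pi> j))" .
    qed (use G arc_R in \<open>auto simp: carrier_matI\<close>)
  qed
  then show "is_arc k R \<and> length R = CARD('a) + 1 \<and>
      (\<forall>G :: 'a vec list. is_arc k G \<and> length G = CARD('a) + 1 \<longrightarrow> linearly_equivalent k B G R)"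
    using arc_R by (simp add: m_def)
qed

end
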